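(* Let $\Omega\subseteq\mathbb{R}^n$ be open. The evaluation map $$\mathrm{ev}:(u,x)\in\mathcal{G}^s(\Omega)\times\widetilde\Omega_c\mapsto u(x)\in\widetilde{\mathbb{R}}$$ is smooth as a map of diffeological spaces, where for $u=[u_\varepsilon]\in\mathcal{G}^s(\Omega)$ and $x=[x_\varepsilon]\in\widetilde\Omega_c$ one sets $u(x):=[u_\varepsilon(x_\varepsilon)]$.
   Context: **Diffeological spaces.** A diffeological space $X=(|X|,\mathcal{D})$ is a set $|X|$ with a family $\mathcal{D}=\bigcup_U\mathcal{D}_U$, $U$ ranging over all open subsets of all $\mathbb{R}^n$, $n\in\mathbb{N}=\{0,1,\dots\}$, where $\mathcal{D}_U$ is a set of functions $U\to|X|$ (plots; write $d\in_U X$) containing all constants, closed under precomposition with ordinary smooth maps $V\to U$, and such that a function $d:U\to|X|$ that is locally (on an open cover of $U$) in $\mathcal{D}$ belongs to $\mathcal{D}_U$. A map $f:X\to Y$ is smooth if it sends plots to plots by composition; $\mathcal{C}^\infty(X,Y)$ is the set of smooth maps with the functional diffeology: $d\in_U\mathcal{C}^\infty(X,Y)$ iff $(u,x)\mapsto d(u)(x)$ is smooth $U\times X\to Y$. Manifolds carry the diffeology of usual smooth maps; products carry the product diffeology (plots are componentwise plots). For $A\subseteq|X|$, $(A\prec X)$ is $A$ with the sub-diffeology (plots are the maps into $A$ that are plots of $X$). A quotient $X/{\sim}$ has the quotient diffeology: plots are the maps that locally lift to plots of $X$. $I=(0,1]$ carries the discrete diffeology (plots are locally constant maps). **Special Colombeau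 algebra.** All $O$-relations are for $\varepsilon\to0^+$; $K\Subset\Omega$ means that $K$ is a compact subset of $\Omega$. $\mathcal{E}^s_M(\Omega)$ is the set of nets $(u_\varepsilon)\in\mathcal{C}^\infty(\Omega)^I$ such that $\forall K\Subset\Omega\,\forall\alpha\in\mathbb{N}^n\,\exists N\in\mathbb{N}$: $\sup_{x\in K}|\partial^\alpha u_\varepsilon(x)|=O(\varepsilon^{-N})$; $\mathcal{N}^s(\Omega)$ is the set of nets such that $\forall K\Subset\Omega\,\forall\alpha\in\mathbb{N}^n\,\forall m\in\mathbb{N}$: $\sup_{x\in K}|\partial^\alpha u_\varepsilon(x)|=O(\varepsilon^m)$. $\mathcal{E}^s_M(\Omega)$ has the sub-diffeology of $\mathcal{C}^\infty(I,\mathcal{C}^\infty(\Omega,\mathbb{R}))$ (plots are maps $d:U\to\mathcal{E}^s_M(\Omega)$ with $(u,x)\mapsto d(u)_\varepsilon(x)$ smooth on $U\times\Omega$ for each $\varepsilon\in I$), and $\mathcal{G}^s(\Omega)=\mathcal{E}^s_M(\Omega)/\mathcal{N}^s(\Omega)$ has the quotient diffeology. **Generalized points and numbers.** $\Omega_M=\{(x_\varepsilon)\in\Omega^I\mid\exists N\in\mathbb{N}:|x_\varepsilon|=O(\varepsilon^{-N})\}$; $(x_\varepsilon)\sim(y_\varepsilon)$ iff $|x_\varepsilon-y_\varepsilon|=O(\varepsilon^m)$ for every $m\in\mathbb{N}$; $\widetilde\Omega=\Omega_M/{\sim}$. $\mathbb{R}_M$ is $\Omega_M$ for $\Omega=\mathbb{R}$,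 and $\widetilde{\mathbb{R}}=\mathbb{R}_M/{\sim}$. $\Omega_c=\{(x_\varepsilon)\in\Omega^I\mid\exists K\Subset\Omega\,\exists\varepsilon_0\,\forall\varepsilon<\varepsilon_0:\ x_\varepsilon\in K\}$ and $\widetilde\Omega_c=\Omega_c/{\sim}$, viewed as a subset of $\widetilde\Omega$. The diffeologies are: $\Omega_M$ has the sub-diffeology of $\mathcal{C}^\infty(I,\Omega)$ (plots are $d:U\to\Omega_M$ with $u\mapsto d(u)_\varepsilon$ smooth for each $\varepsilon$), $\widetilde\Omega$ the quotient diffeology, $\widetilde\Omega_c$ the sub-diffeology of $\widetilde\Omega$; $\mathbb{R}_M$ has the sub-diffeology of $\mathcal{C}^\infty(I,\mathbb{R})$ and $\widetilde{\mathbb{R}}$ the quotient diffeology. *)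

theory Defs
  imports "HOL-Analysis.Analysis" "HOL-Library.Landau_Symbols"
begin

section \<open>Smooth functions on open subsets of Euclidean spaces\<close>

text \<open>
  A diffeology quantifies over open subsets of all \<open>\<real>\<^sup>n\<close> at once, so all of these spaces
  have to live in one type: \<open>\<real>\<^sup>n\<close> is \<^const>\<open>Euclidean_space\<close> \<open>n\<close>, the functions
  \<open>nat \<Rightarrow> real\<close> that vanish from index \<open>n\<close> on (coordinates are \<open>0, \<dots>, n - 1\<close>).  Its topology
  is induced by the topology of \<open>nat \<Rightarrow> real\<close>, hence \<^const>\<open>continuous_on\<close> and \<^const>\<open>compact\<close>
  have their usual Euclidean meaning on subsets of \<open>\<real>\<^sup>n\<close>.
\<close>

type_synonym point = "nat \<Rightarrow> real"

definition partial_deriv :: "nat \<Rightarrow> (point \<Rightarrow> real) \<Rightarrow> point \<Rightarrow> real" where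
  "partial_deriv i f x = deriv (\<lambda>t. f (x(i := t))) (x i)"

text \<open>For a multi-index \<open>\<alpha>\<close> only the entries \<open>\<alpha> 0, \<dots>, \<alpha> (n - 1)\<close> matter.\<close>

definition multi_deriv :: "nat \<Rightarrow> (nat \<Rightarrow> nat) \<Rightarrow> (point \<Rightarrow> real) \<Rightarrow> point \<Rightarrow> real" where
  "multi_deriv n \<alpha> f = foldr (\<lambda>i. partial_deriv i ^^ \<alpha> i) [0..<n] f"

definition smooth_fun :: "nat \<Rightarrow> point set \<Rightarrow> (point \<Rightarrow> real) \<Rightarrow> bool" where
  "smooth_fun n U f \<longleftrightarrow>
     (\<forall>js \<in> lists {..<n}.
        continuous_on U (foldr partial_deriv js f) \<and>
        (\<forall>i<n. \<forall>x\<in>U. (\<lambda>t. foldr partial_deriv js f (x(i := t))) differentiable at (x i)))"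

definition smooth_between ::
    "nat \<Rightarrow> point set \<Rightarrow> nat \<Rightarrow> point set \<Rightarrow> (point \<Rightarrow> point) \<Rightarrow> bool" where
  "smooth_between m V n U f \<longleftrightarrow> f \<in> V \<rightarrow> U \<and> (\<forall>i<n. smooth_fun m V (\<lambda>x. f x i))"


section \<open>Diffeological spaces\<close>

text \<open>
  \<open>plots X n U\<close> is the set of plots \<open>U \<rightarrow> |X|\<close> for \<open>U\<close> open in \<open>\<real>\<^sup>n\<close>.  Functions between sets
  are extensional (\<open>undefined\<close> outside their domain), so that each function on \<open>U\<close> is
  represented exactly once.
\<close>

record 'a diffeology =
  points :: "'a set"
  plots :: "nat \<Rightarrow> point set \<Rightarrow> (point \<Rightarrow> 'a) set"

definition diffeological_space :: "'a diffeology \<Rightarrow> bool" where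
  "diffeological_space X \<longleftrightarrow>
     (\<forall>n U. \<forall>d \<in> plots X n U. openin (Euclidean_space n) U \<and> d \<in> U \<rightarrow>\<^sub>E points X) \<and>
     (\<forall>n U. \<forall>x \<in> points X. openin (Euclidean_space n) U \<longrightarrow> (\<lambda>u\<in>U. x) \<in> plots X n U) \<and>
     (\<forall>m V n U f. \<forall>d \<in> plots X n U.
        openin (Euclidean_space m) V \<and> smooth_between m V n U f \<longrightarrow>
        compose V d f \<in> plots X m V) \<and>
     (\<forall>n U. \<forall>d \<in> U \<rightarrow>\<^sub>E points X.
        openin (Euclidean_space n) U \<and>
        (\<forall>u\<in>U. \<exists>V. u \<in> V \<and> V \<subseteq> U \<and> openin (Euclidean_space n) V \<and> restrict d V \<in> plots X n V) \<longrightarrow>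
        d \<in> plots X n U)"

definition smooth_map :: "'a diffeology \<Rightarrow> 'b diffeology \<Rightarrow> ('a \<Rightarrow> 'b) \<Rightarrow> bool" where
  "smooth_map X Y f \<longleftrightarrow>
     f \<in> points X \<rightarrow> points Y \<and>
     (\<forall>n U. \<forall>d \<in> plots X n U. compose U f d \<in> plots Y n U)"

definition smooth_maps :: "'a diffeology \<Rightarrow> 'b diffeology \<Rightarrow> ('a \<Rightarrow> 'b) set" where
  "smooth_maps X Y = {f \<in> extensional (points X). smooth_map X Y f}"

definition open_diffeology :: "nat \<Rightarrow> point set \<Rightarrow> point diffeology" where
  "open_diffeology n \<Omega> =
     \<lparr>points = \<Omega>,
      plots = \<lambda>m U. {d \<in> U \<rightarrow>\<^sub>E \<Omega>. openin (Euclidean_space m) U \<and> smooth_between m U n \<Omega> d}\<rparr>"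

definition real_diffeology :: "real diffeology" where
  "real_diffeology =
     \<lparr>points = UNIV,
      plots = \<lambda>m U. {d \<in> extensional U. openin (Euclidean_space m) U \<and> smooth_fun m U d}\<rparr>"

definition discrete_diffeology :: "'a set \<Rightarrow> 'a diffeology" where
  "discrete_diffeology S =
     \<lparr>points = S,
      plots = \<lambda>n U. {d \<in> U \<rightarrow>\<^sub>E S. openin (Euclidean_space n) U \<and>
        (\<forall>u\<in>U. \<exists>V. u \<in> V \<and> V \<subseteq> U \<and> openin (Euclidean_space n) V \<and> (\<forall>v\<in>V. d v = d u))}\<rparr>"

definition prod_diffeology :: "'a diffeology \<Rightarrow> 'b diffeology \<Rightarrow> ('a \<times> 'b) diffeology" where
  "prod_diffeology X Y =
     \<lparr>points = points X \<times> points Y,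
      plots = \<lambda>n U. {d \<in> U \<rightarrow>\<^sub>E points X \<times> points Y.
        compose U fst d \<in> plots X n U \<and> compose U snd d \<in> plots Y n U}\<rparr>"

definition sub_diffeology :: "'a set \<Rightarrow> 'a diffeology \<Rightarrow> 'a diffeology" where
  "sub_diffeology A X = \<lparr>points = A, plots = \<lambda>n U. {d \<in> plots X n U. d \<in> U \<rightarrow> A}\<rparr>"

definition quotient_diffeology :: "'a diffeology \<Rightarrow> ('a \<times> 'a) set \<Rightarrow> 'a set diffeology" where
  "quotient_diffeology X r =
     \<lparr>points = points X // r,
      plots = \<lambda>n U. {d \<in> U \<rightarrow>\<^sub>E points X // r. openin (Euclidean_space n) U \<and>
        (\<forall>u\<in>U. \<exists>V. u \<in> V \<and> V \<subseteq> U \<and> openin (Euclidean_space n) V \<and>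
           (\<exists>e \<in> plots X n V. \<forall>v\<in>V. d v = r `` {e v}))}\<rparr>"

definition functional_diffeology ::
    "'a diffeology \<Rightarrow> 'b diffeology \<Rightarrow> ('a \<Rightarrow> 'b) diffeology" where
  "functional_diffeology X Y =
     \<lparr>points = smooth_maps X Y,
      plots = \<lambda>n U. {d \<in> U \<rightarrow>\<^sub>E smooth_maps X Y. openin (Euclidean_space n) U \<and>
        smooth_map (prod_diffeology (open_diffeology n U) X) Y (\<lambda>(u, x). d u x)}\<rparr>"


section \<open>Nets and the special Colombeau algebra\<close>

abbreviation eps_set :: "real set" where
  "eps_set \<equiv> {0<..1}"

definition moderate_net :: "(real \<Rightarrow> real) \<Rightarrow> bool" where
  "moderate_net a \<longleftrightarrow> (\<exists>N::nat. a \<in> O[at_right 0](\<lambda>\<epsilon>. 1 / \<epsilon> ^ N))"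

definition negligible_net :: "(real \<Rightarrow> real) \<Rightarrow> bool" where
  "negligible_net a \<longleftrightarrow> (\<forall>m::nat. a \<in> O[at_right 0](\<lambda>\<epsilon>. \<epsilon> ^ m))"

definition smooth_functions_space :: "nat \<Rightarrow> point set \<Rightarrow> (point \<Rightarrow> real) diffeology" where
  "smooth_functions_space n \<Omega> = functional_diffeology (open_diffeology n \<Omega>) real_diffeology"

text \<open>
  The empty compact set is left out because \<open>Sup {}\<close> is not \<open>0\<close> on the reals; its condition
  would be void.
\<close>

definition moderate_funs :: "nat \<Rightarrow> point set \<Rightarrow> (real \<Rightarrow> point \<Rightarrow> real) set" where
  "moderate_funs n \<Omega> =
     {u \<in> eps_set \<rightarrow>\<^sub>E points (smooth_functions_space n \<Omega>).
        \<forall>K \<alpha>. compact K \<and> K \<subseteq> \<Omega> \<and> K \<noteq> {} \<longrightarrow>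
          moderate_net (\<lambda>\<epsilon>. SUP x\<in>K. \<bar>multi_deriv n \<alpha> (u \<epsilon>) x\<bar>)}"

definition negligible_funs :: "nat \<Rightarrow> point set \<Rightarrow> (real \<Rightarrow> point \<Rightarrow> real) set" where
  "negligible_funs n \<Omega> =
     {u \<in> eps_set \<rightarrow>\<^sub>E points (smooth_functions_space n \<Omega>).
        \<forall>K \<alpha>. compact K \<and> K \<subseteq> \<Omega> \<and> K \<noteq> {} \<longrightarrow>
          negligible_net (\<lambda>\<epsilon>. SUP x\<in>K. \<bar>multi_deriv n \<alpha> (u \<epsilon>) x\<bar>)}"

definition fun_rel ::
    "nat \<Rightarrow> point set \<Rightarrow> ((real \<Rightarrow> point \<Rightarrow> real) \<times> (real \<Rightarrow> point \<Rightarrow> real)) set" where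
  "fun_rel n \<Omega> =
     {(u, v). u \<in> moderate_funs n \<Omega> \<and> v \<in> moderate_funs n \<Omega> \<and>
        (\<lambda>\<epsilon>\<in>eps_set. \<lambda>x\<in>\<Omega>. u \<epsilon> x - v \<epsilon> x) \<in> negligible_funs n \<Omega>}"

definition moderate_funs_space :: "nat \<Rightarrow> point set \<Rightarrow> (real \<Rightarrow> point \<Rightarrow> real) diffeology" where
  "moderate_funs_space n \<Omega> =
     sub_diffeology (moderate_funs n \<Omega>)
       (functional_diffeology (discrete_diffeology eps_set) (smooth_functions_space n \<Omega>))"

definition special_colombeau ::
    "nat \<Rightarrow> point set \<Rightarrow> (real \<Rightarrow> point \<Rightarrow> real) set diffeology" where
  "special_colombeau n \<Omega> = quotient_diffeology (moderate_funs_space n \<Omega>) (fun_rel n \<Omega>)"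


section \<open>Generalized points and numbers\<close>

text \<open>\<open>L2_set x {..<n}\<close> is the Euclidean norm of \<open>x\<close> in \<open>\<real>\<^sup>n\<close>.\<close>

definition moderate_points :: "nat \<Rightarrow> point set \<Rightarrow> (real \<Rightarrow> point) set" where
  "moderate_points n \<Omega> =
     {x \<in> eps_set \<rightarrow>\<^sub>E \<Omega>. moderate_net (\<lambda>\<epsilon>. L2_set (x \<epsilon>) {..<n})}"

definition point_rel :: "nat \<Rightarrow> point set \<Rightarrow> ((real \<Rightarrow> point) \<times> (real \<Rightarrow> point)) set" where
  "point_rel n \<Omega> =
     {(x, y). x \<in> moderate_points n \<Omega> \<and> y \<in> moderate_points n \<Omega> \<and>
        negligible_net (\<lambda>\<epsilon>. L2_set (\<lambda>i. x \<epsilon> i - y \<epsilon> i) {..<n})}"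

definition moderate_points_space :: "nat \<Rightarrow> point set \<Rightarrow> (real \<Rightarrow> point) diffeology" where
  "moderate_points_space n \<Omega> =
     sub_diffeology (moderate_points n \<Omega>)
       (functional_diffeology (discrete_diffeology eps_set) (open_diffeology n \<Omega>))"

definition generalized_points :: "nat \<Rightarrow> point set \<Rightarrow> (real \<Rightarrow> point) set diffeology" where
  "generalized_points n \<Omega> = quotient_diffeology (moderate_points_space n \<Omega>) (point_rel n \<Omega>)"

definition compact_points :: "point set \<Rightarrow> (real \<Rightarrow> point) set" where
  "compact_points \<Omega> =
     {x \<in> eps_set \<rightarrow>\<^sub>E \<Omega>.
        \<exists>K \<epsilon>0. compact K \<and> K \<subseteq> \<Omega> \<and> \<epsilon>0 > 0 \<and> (\<forall>\<epsilon>\<in>eps_set. \<epsilon> < \<epsilon>0 \<longrightarrow> x \<epsilon> \<in> K)}"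

text \<open>Here the equivalence classes are still those of \<^const>\<open>point_rel\<close> on all moderate points.\<close>

definition compact_generalized_points ::
    "nat \<Rightarrow> point set \<Rightarrow> (real \<Rightarrow> point) set diffeology" where
  "compact_generalized_points n \<Omega> =
     sub_diffeology (compact_points \<Omega> // point_rel n \<Omega>) (generalized_points n \<Omega>)"

definition moderate_reals :: "(real \<Rightarrow> real) set" where
  "moderate_reals = {a \<in> eps_set \<rightarrow>\<^sub>E UNIV. moderate_net (\<lambda>\<epsilon>. \<bar>a \<epsilon>\<bar>)}"

definition real_rel :: "((real \<Rightarrow> real) \<times> (real \<Rightarrow> real)) set" where
  "real_rel =
     {(a, b). a \<in> moderate_reals \<and> b \<in> moderate_reals \<and> negligible_net (\<lambda>\<epsilon>. \<bar>a \<epsilon> - b \<epsilon>\<bar>)}"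

definition moderate_reals_space :: "(real \<Rightarrow> real) diffeology" where
  "moderate_reals_space =
     sub_diffeology moderate_reals
       (functional_diffeology (discrete_diffeology eps_set) real_diffeology)"

definition generalized_reals :: "(real \<Rightarrow> real) set diffeology" where
  "generalized_reals = quotient_diffeology moderate_reals_space real_rel"


section \<open>Evaluation of generalized functions at generalized points\<close>

text \<open>
  As usual for functions on quotient sets, the value is the union of the classes obtained from
  all representatives; it is a single class once independence of the representatives is known.
\<close>

definition gen_eval ::
    "(real \<Rightarrow> point \<Rightarrow> real) set \<times> (real \<Rightarrow> point) set \<Rightarrow> (real \<Rightarrow> real) set" where
  "gen_eval = (\<lambda>(u, x). \<Union>v\<in>u. \<Union>y\<in>x. real_rel `` {\<lambda>\<epsilon>\<in>eps_set. v \<epsilon> (y \<epsilon>)})"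


section \<open>Calculus of smooth functions\<close>

lemma Euclidean_space_eq: "Euclidean_space n = top_of_set {x. \<forall>i\<ge>n. x i = 0}"
  by (simp add: Euclidean_space_def euclidean_product_topology)

lemma open_imp_points: "openin (Euclidean_space n) U \<Longrightarrow> x \<in> U \<Longrightarrow> i \<ge> n \<Longrightarrow> x i = 0"
  using openin_subset[of "Euclidean_space n" U] by (auto simp: topspace_Euclidean_space)

lemma open_box:
  assumes "openin (Euclidean_space n) U" "x \<in> U"
  obtains \<delta> where "\<delta> > 0"
    "\<And>y. (\<forall>i<n. \<bar>y i - x i\<bar> < \<delta>) \<Longrightarrow> (\<forall>i\<ge>n. y i = 0) \<Longrightarrow> y \<in> U"
proof -
  obtain T where T: "openin (powertop_real UNIV) T" "U = T \<inter> {x. \<forall>i\<ge>n. x i = 0}"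
    using assms(1) unfolding Euclidean_space_def by (auto simp: openin_subtopology)
  obtain X where X: "x \<in> (\<Pi>\<^sub>E i\<in>UNIV. X i)" "\<And>i. open (X i)" "(\<Pi>\<^sub>E i\<in>UNIV. X i) \<subseteq> T"
    using product_topology_open_contains_basis[OF T(1), of x] assms(2) T(2) by auto
  have "\<exists>e>0. ball (x i) e \<subseteq> X i" for i
    using X(1,2) by (auto simp: PiE_iff open_contains_ball)
  then obtain e where e: "\<And>i. e i > 0" "\<And>i. ball (x i) (e i) \<subseteq> X i" by metis
  define \<delta> where "\<delta> = Min (insert 1 (e ` {..<n}))"
  have d0: "\<delta> > 0" using e(1) by (auto simp: \<delta>_def)
  have dle: "\<delta> \<le> e i" if "i < n" for i
    using that by (auto simp: \<delta>_def intro!: Min_le)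
  show thesis
  proof (rule that[OF d0])
    fix y assume y: "\<forall>i<n. \<bar>y i - x i\<bar> < \<delta>" "\<forall>i\<ge>n. y i = (0::real)"
    have "y i \<in> X i" for i
    proof (cases "i < n")
      case True
      then have "y i \<in> ball (x i) (e i)"
        using y(1) dle[of i] by (force simp: dist_real_def abs_minus_commute)
      then show ?thesis using e(2) by blast
    next
      case False
      then have "x i = y i" using y(2) open_imp_points[OF assms, of i] by simp
      moreover have "x i \<in> X i" using X(1) by (auto simp: PiE_iff)
      ultimately show ?thesis by simp
    qed
    then show "y \<in> U" using X(3) y(2) by (auto simp: T(2) PiE_iff)
  qed
qed

lemma continuous_box:
  assumes "openin (Euclidean_space n) U" "x \<in> U" "continuous_on U h" "e > 0"
  obtains \<delta> where "\<delta> > 0"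
    "\<And>y. (\<forall>i<n. \<bar>y i - x i\<bar> < \<delta>) \<Longrightarrow> (\<forall>i\<ge>n. y i = 0) \<Longrightarrow> y \<in> U \<and> \<bar>h y - h x\<bar> < (e::real)"
proof -
  have "openin (top_of_set U) (U \<inter> h -` ball (h x) e)"
    by (intro continuous_openin_preimage_gen assms) auto
  then have "openin (Euclidean_space n) (U \<inter> h -` ball (h x) e)"
    using assms(1) unfolding Euclidean_space_eq by (rule openin_trans)
  from open_box[OF this, of x] assms(2,4) obtain \<delta> where "\<delta> > 0"
    "\<And>y. (\<forall>i<n. \<bar>y i - x i\<bar> < \<delta>) \<Longrightarrow> (\<forall>i\<ge>n. y i = 0) \<Longrightarrow> y \<in> U \<inter> h -` ball (h x) e"
    by auto
  then show thesis using that by (force simp: dist_real_def abs_minus_commute)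
qed

lemma eventually_line:
  assumes "openin (Euclidean_space n) U" "x \<in> U" "i < n"
  shows "eventually (\<lambda>t. x(i := t) \<in> U) (nhds (x i))"
proof -
  obtain \<delta> where d: "\<delta> > 0"
    "\<And>y. (\<forall>i<n. \<bar>y i - x i\<bar> < \<delta>) \<Longrightarrow> (\<forall>i\<ge>n. y i = 0) \<Longrightarrow> y \<in> U"
    using open_box[OF assms(1,2)] by blast
  have "x(i := t) \<in> U" if "dist t (x i) < \<delta>" for t
    using that assms(3) d(1) open_imp_points[OF assms(1,2)]
    by (intro d(2)) (auto simp: dist_real_def)
  then show ?thesis using d(1) unfolding eventually_nhds_metric by blast
qed

lemma partial_deriv_cong:
  assumes "openin (Euclidean_space n) U" "x \<in> U" "i < n" "\<And>y. y \<in> U \<Longrightarrow> f y = g y"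
  shows "partial_deriv i f x = partial_deriv i g x"
  unfolding partial_deriv_def
  by (rule deriv_cong_ev) (auto intro: eventually_mono[OF eventually_line[OF assms(1-3)]] assms(4))

lemma partial_differentiable_cong:
  fixes f g :: "point \<Rightarrow> real"
  assumes "openin (Euclidean_space n) U" "x \<in> U" "i < n" "\<And>y. y \<in> U \<Longrightarrow> f y = g y"
  shows "(\<lambda>t. f (x(i := t))) differentiable at (x i) \<longleftrightarrow>
         (\<lambda>t. g (x(i := t))) differentiable at (x i)"
proof -
  have "DERIV (\<lambda>t. f (x(i := t))) (x i) :> D \<longleftrightarrow> DERIV (\<lambda>t. g (x(i := t))) (x i) :> D" for D
    by (rule DERIV_cong_ev) (auto intro: eventually_mono[OF eventually_line[OF assms(1-3)]] assms(4))
  then show ?thesis by (simp add: real_differentiable_def)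
qed

lemma smooth_fun_coinduct:
  assumes "openin (Euclidean_space n) U" "P f"
    and "\<And>g. P g \<Longrightarrow> continuous_on U g"
    and "\<And>g i x. P g \<Longrightarrow> i < n \<Longrightarrow> x \<in> U \<Longrightarrow> (\<lambda>t. g (x(i := t))) differentiable at (x i)"
    and "\<And>g i. P g \<Longrightarrow> i < n \<Longrightarrow> \<exists>h. P h \<and> (\<forall>x\<in>U. partial_deriv i g x = h x)"
  shows "smooth_fun n U f"
proof -
  have *: "\<exists>h. P h \<and> (\<forall>x\<in>U. foldr partial_deriv js f x = h x)" if "js \<in> lists {..<n}" for js
    using that
  proof (induction js)
    case Nil
    then show ?case using assms(2) by auto
  next
    case (Cons i js)
    then obtain h where h: "P h" "\<forall>x\<in>U. foldr partial_deriv js f x = h x" by auto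
    have "i < n" using Cons by auto
    then obtain h' where "P h'" "\<forall>x\<in>U. partial_deriv i h x = h' x"
      using assms(5)[OF h(1)] by blast
    then show ?case
      using partial_deriv_cong[OF assms(1), of _ i "foldr partial_deriv js f" h] h(2) Cons by auto
  qed
  show ?thesis unfolding smooth_fun_def
  proof (intro ballI)
    fix js assume "js \<in> lists {..<n}"
    from *[OF this] obtain h where h: "P h" "\<forall>x\<in>U. foldr partial_deriv js f x = h x" by auto
    show "continuous_on U (foldr partial_deriv js f) \<and>
        (\<forall>i<n. \<forall>x\<in>U. (\<lambda>t. foldr partial_deriv js f (x(i := t))) differentiable at (x i))"
      using assms(3,4)[OF h(1)] h(2) partial_differentiable_cong[OF assms(1), of _ _ "foldr partial_deriv js f" h]
      by (simp cong: continuous_on_cong)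
  qed
qed

lemma smooth_fun_continuous: "smooth_fun n U f \<Longrightarrow> continuous_on U f"
  unfolding smooth_fun_def by (drule bspec[of _ _ "[]"]) auto

lemma smooth_fun_DERIV:
  assumes "smooth_fun n U f" "i < n" "x \<in> U"
  shows "DERIV (\<lambda>t. f (x(i := t))) (x i) :> partial_deriv i f x"
  using assms unfolding smooth_fun_def partial_deriv_def DERIV_deriv_iff_real_differentiable
  by (auto dest!: bspec[of _ _ "[]"])

lemma smooth_fun_partial: "smooth_fun n U f \<Longrightarrow> i < n \<Longrightarrow> smooth_fun n U (partial_deriv i f)"
  unfolding smooth_fun_def
proof (intro ballI)
  fix js assume *: "\<forall>js\<in>lists {..<n}.
       continuous_on U (foldr partial_deriv js f) \<and>
       (\<forall>i<n. \<forall>x\<in>U. (\<lambda>t. foldr partial_deriv js f (x(i := t))) differentiable at (x i))"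
    "i < n" "js \<in> lists {..<n}"
  show "continuous_on U (foldr partial_deriv js (partial_deriv i f)) \<and>
       (\<forall>k<n. \<forall>x\<in>U. (\<lambda>t. foldr partial_deriv js (partial_deriv i f) (x(k := t))) differentiable at (x k))"
    using *(1)[rule_format, of "js @ [i]"] *(2,3) by simp
qed

lemma smooth_fun_local:
  assumes "\<And>x. x \<in> U \<Longrightarrow> \<exists>V. x \<in> V \<and> V \<subseteq> U \<and> openin (Euclidean_space n) V \<and> smooth_fun n V f"
  shows "smooth_fun n U f"
  unfolding smooth_fun_def
proof (intro ballI conjI allI impI)
  fix js assume js: "js \<in> lists {..<n}"
  have U: "openin (Euclidean_space n) U"
    using assms by (subst openin_subopen) blast
  show "continuous_on U (foldr partial_deriv js f)"
    unfolding continuous_on_eq_continuous_within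
  proof
    fix x assume x: "x \<in> U"
    then obtain V where V: "x \<in> V" "V \<subseteq> U" "openin (Euclidean_space n) V" "smooth_fun n V f"
      using assms by blast
    then have "continuous (at x within V) (foldr partial_deriv js f)"
      using js unfolding smooth_fun_def continuous_on_eq_continuous_within by blast
    moreover obtain T where "open T" "V = T \<inter> {x. \<forall>i\<ge>n. x i = 0}"
      using V(3) unfolding Euclidean_space_eq by (auto simp: openin_open)
    then have "at x within V = at x within U"
      using V(1,2) openin_subset[OF U]
      by (intro at_within_nhd[of x T]) (auto simp: topspace_Euclidean_space)
    ultimately show "continuous (at x within U) (foldr partial_deriv js f)"
      by (simp add: continuous_within)
  qed
next
  fix js i x assume "js \<in> lists {..<n}" "i < n" "x \<in> U"
  then show "(\<lambda>t. foldr partial_deriv js f (x(i := t))) differentiable at (x i)"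
    using assms[of x] unfolding smooth_fun_def by blast
qed

lemma smooth_fun_subset: "smooth_fun n U f \<Longrightarrow> V \<subseteq> U \<Longrightarrow> smooth_fun n V f"
  unfolding smooth_fun_def by (meson continuous_on_subset subsetD)

lemma smooth_fun_cong:
  assumes "openin (Euclidean_space n) U" "smooth_fun n U f" "\<And>x. x \<in> U \<Longrightarrow> f x = g x"
  shows "smooth_fun n U g"
proof (rule smooth_fun_coinduct[where P = "\<lambda>g. \<exists>f. smooth_fun n U f \<and> (\<forall>x\<in>U. f x = g x)"])
  fix g assume "\<exists>f. smooth_fun n U f \<and> (\<forall>x\<in>U. f x = g x)"
  then obtain f where f: "smooth_fun n U f" "\<And>x. x \<in> U \<Longrightarrow> f x = g x" by blast
  show "continuous_on U g"
    using smooth_fun_continuous[OF f(1)] f(2) by (simp cong: continuous_on_cong)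
  show "(\<lambda>t. g (x(i := t))) differentiable at (x i)" if "i < n" "x \<in> U" for i x
    using partial_differentiable_cong[OF assms(1) that(2,1), of f g] f(2) smooth_fun_DERIV[OF f(1) that]
    by (simp add: real_differentiable_def) blast
  show "\<exists>h. (\<exists>f. smooth_fun n U f \<and> (\<forall>x\<in>U. f x = h x)) \<and> (\<forall>x\<in>U. partial_deriv i g x = h x)"
    if "i < n" for i
    using smooth_fun_partial[OF f(1) that] partial_deriv_cong[OF assms(1) _ that, of _ f g] f(2)
    by (intro exI[of _ "partial_deriv i f"] conjI) auto
qed (use assms in auto)

lemma chain_rule_curve:
  assumes U: "openin (Euclidean_space n) U" and f: "smooth_fun n U f"
    and p: "\<gamma> t0 \<in> U" and z: "\<And>t i. i \<ge> n \<Longrightarrow> \<gamma> t i = 0"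
    and d: "\<And>i. i < n \<Longrightarrow> DERIV (\<lambda>t. \<gamma> t i) t0 :> c i"
  shows "DERIV (\<lambda>t. f (\<gamma> t)) t0 :> (\<Sum>i<n. c i * partial_deriv i f (\<gamma> t0))"
proof -
  define p where "p = \<gamma> t0"
  define q where "q k t = (\<lambda>i. if i < k then \<gamma> t i else p i)" for k t
  have close: "eventually (\<lambda>t. \<forall>i<n. \<bar>\<gamma> t i - p i\<bar> < \<delta>) (at t0)" if "\<delta> > 0" for \<delta>
  proof -
    have "eventually (\<lambda>t. \<forall>i\<in>{..<n}. \<bar>\<gamma> t i - p i\<bar> < \<delta>) (at t0)"
    proof (rule eventually_ball_finite)
      show "\<forall>i\<in>{..<n}. eventually (\<lambda>t. \<bar>\<gamma> t i - p i\<bar> < \<delta>) (at t0)"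
        using tendstoD[OF DERIV_isCont[OF d, unfolded isCont_def] that]
        by (auto simp: p_def dist_real_def)
    qed auto
    then show ?thesis by (auto elim: eventually_mono)
  qed
  have "DERIV (\<lambda>t. f (q k t)) t0 :> (\<Sum>i<k. c i * partial_deriv i f p)" if "k \<le> n" for k
    using that
  proof (induction k)
    case 0
    then show ?case by (simp add: q_def)
  next
    case (Suc k)
    then have k: "k < n" by auto
    define D where "D t = f (q (Suc k) t) - f (q k t)" for t
    have eqS: "q (Suc k) t = (q k t)(k := \<gamma> t k)" for t by (auto simp: q_def)
    have D0: "D t0 = 0"
      by (simp add: D_def eqS) (simp add: q_def p_def fun_upd_idem)
    obtain \<delta>0 where d0: "\<delta>0 > 0"
      "\<And>y. (\<forall>i<n. \<bar>y i - p i\<bar> < \<delta>0) \<Longrightarrow> (\<forall>i\<ge>n. y i = 0) \<Longrightarrow> y \<in> U"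
      using open_box[OF U, of p] assms(3) p_def by blast
    have pz: "p i = 0" if "i \<ge> n" for i using z that by (simp add: p_def)
    have ex: "\<exists>s. \<bar>s - p k\<bar> \<le> \<bar>\<gamma> t k - p k\<bar> \<and>
         D t = partial_deriv k f ((q k t)(k := s)) * (\<gamma> t k - p k)"
      if t: "\<forall>i<n. \<bar>\<gamma> t i - p i\<bar> < \<delta>0" for t
    proof -
      define \<phi> where "\<phi> s = f ((q k t)(k := s))" for s
      have inU: "(q k t)(k := s) \<in> U" if "\<bar>s - p k\<bar> \<le> \<bar>\<gamma> t k - p k\<bar>" for s
      proof (rule d0(2))
        show "\<forall>i<n. \<bar>((q k t)(k := s)) i - p i\<bar> < \<delta>0"
          using t that d0(1) k by (fastforce simp: q_def)
        show "\<forall>i\<ge>n. ((q k t)(k := s)) i = 0" using k z pz by (auto simp: q_def)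
      qed
      have der: "DERIV \<phi> s :> partial_deriv k f ((q k t)(k := s))"
        if "\<bar>s - p k\<bar> \<le> \<bar>\<gamma> t k - p k\<bar>" for s
        using smooth_fun_DERIV[OF f k inU[OF that]] by (simp add: \<phi>_def[abs_def])
      have Dt: "D t = \<phi> (\<gamma> t k) - \<phi> (p k)"
      proof -
        have "(q k t)(k := p k) = q k t" by (simp add: q_def fun_upd_idem)
        then show ?thesis unfolding D_def \<phi>_def eqS by simp
      qed
      consider "\<gamma> t k = p k" | "p k < \<gamma> t k" | "\<gamma> t k < p k" by linarith
      then show ?thesis
      proof cases
        case 1
        then show ?thesis using Dt by auto
      next
        case 2
        then obtain s where "p k < s" "s < \<gamma> t k"
          "\<phi> (\<gamma> t k) - \<phi> (p k) = (\<gamma> t k - p k) * partial_deriv k f ((q k t)(k := s))"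
          using MVT2[of "p k" "\<gamma> t k" \<phi> "\<lambda>s. partial_deriv k f ((q k t)(k := s))"] der by force
        then show ?thesis using Dt by (intro exI[of _ s]) (auto simp: algebra_simps)
      next
        case 3
        then obtain s where "\<gamma> t k < s" "s < p k"
          "\<phi> (p k) - \<phi> (\<gamma> t k) = (p k - \<gamma> t k) * partial_deriv k f ((q k t)(k := s))"
          using MVT2[of "\<gamma> t k" "p k" \<phi> "\<lambda>s. partial_deriv k f ((q k t)(k := s))"] der by force
        then show ?thesis using Dt by (intro exI[of _ s]) (auto simp: algebra_simps)
      qed
    qed
    then obtain s where s: "\<And>t. \<forall>i<n. \<bar>\<gamma> t i - p i\<bar> < \<delta>0 \<Longrightarrow> \<bar>s t - p k\<bar> \<le> \<bar>\<gamma> t k - p k\<bar> \<and>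
         D t = partial_deriv k f ((q k t)(k := s t)) * (\<gamma> t k - p k)"
      by metis
    have lim: "((\<lambda>t. partial_deriv k f ((q k t)(k := s t))) \<longlongrightarrow> partial_deriv k f p) (at t0)"
    proof (rule tendstoI)
      fix e :: real assume "e > 0"
      then obtain \<delta> where \<delta>: "\<delta> > 0"
        "\<And>y. (\<forall>i<n. \<bar>y i - p i\<bar> < \<delta>) \<Longrightarrow> (\<forall>i\<ge>n. y i = 0) \<Longrightarrow>
           y \<in> U \<and> \<bar>partial_deriv k f y - partial_deriv k f p\<bar> < e"
        using continuous_box[OF U _ smooth_fun_continuous[OF smooth_fun_partial[OF f k]], of p e]
          assms(3) p_def by metis
      show "eventually (\<lambda>t. dist (partial_deriv k f ((q k t)(k := s t))) (partial_deriv k f p) < e) (at t0)"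
        using close[OF \<delta>(1)] close[OF d0(1)]
      proof eventually_elim
        case (elim t)
        have "\<bar>s t - p k\<bar> < \<delta>" using s[of t] elim k by force
        then have "\<forall>i<n. \<bar>((q k t)(k := s t)) i - p i\<bar> < \<delta>"
          using elim \<delta>(1) by (auto simp: q_def)
        moreover have "\<forall>i\<ge>n. ((q k t)(k := s t)) i = 0" using k z pz by (auto simp: q_def)
        ultimately show ?case using \<delta>(2) by (auto simp: dist_real_def)
      qed
    qed
    have "((\<lambda>t. partial_deriv k f ((q k t)(k := s t)) * ((\<gamma> t k - p k) / (t - t0)))
        \<longlongrightarrow> partial_deriv k f p * c k) (at t0)"
      using d[OF k] by (intro tendsto_mult lim) (simp add: has_field_derivative_iff p_def)
    moreover have "eventually (\<lambda>t. partial_deriv k f ((q k t)(k := s t)) * ((\<gamma> t k - p k) / (t - t0))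
        = (D t - D t0) / (t - t0)) (at t0)"
      using close[OF d0(1)] by eventually_elim (use s D0 in auto)
    ultimately have "((\<lambda>t. (D t - D t0) / (t - t0)) \<longlongrightarrow> partial_deriv k f p * c k) (at t0)"
      by (rule Lim_transform_eventually)
    then have "DERIV D t0 :> c k * partial_deriv k f p"
      by (simp add: has_field_derivative_iff mult.commute)
    from DERIV_add[OF Suc.IH this] k show ?case
      by (simp add: D_def)
  qed
  from this[of n] have "DERIV (\<lambda>t. f (q n t)) t0 :> (\<Sum>i<n. c i * partial_deriv i f p)" by simp
  moreover have "q n t = \<gamma> t" for t using z by (auto simp: q_def p_def)
  ultimately show ?thesis by (simp add: p_def)
qed

inductive comp_alg :: "nat \<Rightarrow> point set \<Rightarrow> nat \<Rightarrow> point set \<Rightarrow> (point \<Rightarrow> point) \<Rightarrow> (point \<Rightarrow> real) \<Rightarrow> bool"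
  for m V n U g where
  comp: "smooth_fun n U f \<Longrightarrow> comp_alg m V n U g (\<lambda>x. f (g x))"
| base: "smooth_fun m V h \<Longrightarrow> comp_alg m V n U g h"
| zero: "comp_alg m V n U g (\<lambda>_. 0)"
| add: "comp_alg m V n U g h \<Longrightarrow> comp_alg m V n U g k \<Longrightarrow> comp_alg m V n U g (\<lambda>x. h x + k x)"
| mult: "comp_alg m V n U g h \<Longrightarrow> comp_alg m V n U g k \<Longrightarrow> comp_alg m V n U g (\<lambda>x. h x * k x)"

lemma comp_alg_sum:
  assumes "\<And>k. k < N \<Longrightarrow> comp_alg m V n U g (F k)"
  shows "comp_alg m V n U g (\<lambda>x. \<Sum>k<(N::nat). F k x)"
  using assms by (induction N) (auto intro: comp_alg.zero comp_alg.add)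

lemma smooth_between_continuous:
  assumes "openin (Euclidean_space n) U" "smooth_between m V n U g"
  shows "continuous_on V g"
proof (rule continuous_on_coordinatewise_then_product)
  fix i
  show "continuous_on V (\<lambda>x. g x i)"
  proof (cases "i < n")
    case True
    then show ?thesis using assms(2) smooth_fun_continuous by (auto simp: smooth_between_def)
  next
    case False
    have "g x i = 0" if "x \<in> V" for x
      using open_imp_points[OF assms(1), of "g x" i] that False assms(2)
      by (auto simp: smooth_between_def)
    then show ?thesis by (simp cong: continuous_on_cong)
  qed
qed

lemma comp_alg_continuous:
  assumes "openin (Euclidean_space n) U" "smooth_between m V n U g" "comp_alg m V n U g h"
  shows "continuous_on V h"
  using assms(3)
proof induction
  case (comp f)
  then show ?case
    using continuous_on_compose2[OF smooth_fun_continuous smooth_between_continuous[OF assms(1,2)]] assms(2)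
    by (auto simp: smooth_between_def)
qed (auto intro: smooth_fun_continuous continuous_intros)

lemma comp_alg_DERIV:
  assumes "openin (Euclidean_space n) U" "openin (Euclidean_space m) V"
    "smooth_between m V n U g" "comp_alg m V n U g h" "i < m"
  shows "\<exists>h'. comp_alg m V n U g h' \<and> (\<forall>x\<in>V. DERIV (\<lambda>t. h (x(i := t))) (x i) :> h' x)"
  using assms(4)
proof induction
  case (comp f)
  define h' where "h' = (\<lambda>x. \<Sum>k<n. partial_deriv i (\<lambda>y. g y k) x * partial_deriv k f (g x))"
  have "comp_alg m V n U g h'" unfolding h'_def
    using assms(3,5) comp
    by (intro comp_alg_sum comp_alg.mult comp_alg.base comp_alg.comp smooth_fun_partial)
      (auto simp: smooth_between_def)
  moreover have "DERIV (\<lambda>t. f (g (x(i := t)))) (x i) :> h' x" if x: "x \<in> V" for x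
  proof -
    define \<gamma> where "\<gamma> t = (\<lambda>k. if k < n then g (x(i := t)) k else 0)" for t
    have ge: "\<gamma> t = g (x(i := t))" if "x(i := t) \<in> V" for t
    proof -
      have "g (x(i := t)) \<in> U" using assms(3) that by (auto simp: smooth_between_def)
      then show ?thesis using open_imp_points[OF assms(1)] by (simp add: \<gamma>_def fun_eq_iff)
    qed
    have g0: "\<gamma> (x i) = g x" using ge[of "x i"] x by simp
    have "DERIV (\<lambda>t. f (\<gamma> t)) (x i) :>
        (\<Sum>k<n. partial_deriv i (\<lambda>y. g y k) x * partial_deriv k f (\<gamma> (x i)))"
    proof (rule chain_rule_curve[OF assms(1) comp])
      show "\<gamma> (x i) \<in> U" using g0 x assms(3) by (auto simp: smooth_between_def)
      show "DERIV (\<lambda>t. \<gamma> t k) (x i) :> partial_deriv i (\<lambda>y. g y k) x" if "k < n" for k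
        using smooth_fun_DERIV[of m V "\<lambda>y. g y k" i x] assms(3,5) x that
        by (auto simp: \<gamma>_def smooth_between_def)
    qed (auto simp: \<gamma>_def)
    moreover have ev: "eventually (\<lambda>t. f (\<gamma> t) = f (g (x(i := t)))) (nhds (x i))"
      using eventually_line[OF assms(2) x assms(5)] by eventually_elim (simp add: ge)
    ultimately show ?thesis
      using DERIV_cong_ev[OF refl ev refl] by (simp add: g0 h'_def)
  qed
  ultimately show ?case by blast
next
  case (base h)
  then show ?case
    using smooth_fun_DERIV[OF base assms(5)] smooth_fun_partial[OF base assms(5)]
    by (blast intro: comp_alg.base)
next
  case zero
  then show ?case by (intro exI[of _ "\<lambda>_. 0"]) (auto intro: comp_alg.zero)
next
  case (add h k)
  then obtain h' k' where *: "comp_alg m V n U g h'" "comp_alg m V n U g k'"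
    "\<And>x. x \<in> V \<Longrightarrow> DERIV (\<lambda>t. h (x(i := t))) (x i) :> h' x"
    "\<And>x. x \<in> V \<Longrightarrow> DERIV (\<lambda>t. k (x(i := t))) (x i) :> k' x" by blast
  show ?case
    by (intro exI[of _ "\<lambda>x. h' x + k' x"] conjI comp_alg.add * ballI DERIV_add)
next
  case (mult h k)
  then obtain h' k' where *: "comp_alg m V n U g h'" "comp_alg m V n U g k'"
    "\<And>x. x \<in> V \<Longrightarrow> DERIV (\<lambda>t. h (x(i := t))) (x i) :> h' x"
    "\<And>x. x \<in> V \<Longrightarrow> DERIV (\<lambda>t. k (x(i := t))) (x i) :> k' x" by blast
  show ?case
  proof (intro exI[of _ "\<lambda>x. h' x * k x + k' x * h x"] conjI comp_alg.add comp_alg.mult * mult.hyps ballI)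
    fix x assume "x \<in> V"
    from DERIV_mult[OF *(3,4)[OF this]]
    show "DERIV (\<lambda>t. h (x(i := t)) * k (x(i := t))) (x i) :> h' x * k x + k' x * h x"
      by (simp)
  qed
qed

lemma smooth_fun_compose:
  assumes "openin (Euclidean_space n) U" "openin (Euclidean_space m) V"
    "smooth_between m V n U g" "smooth_fun n U f"
  shows "smooth_fun m V (\<lambda>x. f (g x))"
proof (rule smooth_fun_coinduct[OF assms(2), where P = "comp_alg m V n U g"])
  show "comp_alg m V n U g (\<lambda>x. f (g x))" using assms(4) by (rule comp_alg.comp)
next
  fix h assume h: "comp_alg m V n U g h"
  show "continuous_on V h" using comp_alg_continuous[OF assms(1,3) h] .
  fix i assume i: "i < m"
  obtain h' where h': "comp_alg m V n U g h'" "\<And>x. x \<in> V \<Longrightarrow> DERIV (\<lambda>t. h (x(i := t))) (x i) :> h' x"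
    using comp_alg_DERIV[OF assms(1-3) h i] by blast
  show "\<exists>k. comp_alg m V n U g k \<and> (\<forall>x\<in>V. partial_deriv i h x = k x)"
    using h' DERIV_imp_deriv unfolding partial_deriv_def by blast
  show "(\<lambda>t. h (x(i := t))) differentiable at (x i)" if "x \<in> V" for x
    using h'(2)[OF that] by (auto simp: real_differentiable_def)
qed

lemma smooth_fun_const:
  assumes "openin (Euclidean_space n) U"
  shows "smooth_fun n U (\<lambda>_. c)"
  by (rule smooth_fun_coinduct[OF assms, where P = "\<lambda>f. \<exists>c. f = (\<lambda>_. c)"])
    (auto simp: partial_deriv_def)

lemma smooth_fun_coord:
  assumes "openin (Euclidean_space n) U"
  shows "smooth_fun n U (\<lambda>x. x k)"
proof (rule smooth_fun_coinduct[OF assms, where P = "\<lambda>f. f = (\<lambda>x. x k) \<or> (\<exists>c. f = (\<lambda>_. c))"])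
  fix g :: "point \<Rightarrow> real" and i
  assume g: "g = (\<lambda>x. x k) \<or> (\<exists>c. g = (\<lambda>_. c))"
  show "continuous_on U g" using g by (auto intro: continuous_intros continuous_on_product_then_coordinatewise)
  show "(\<lambda>t. g (x(i := t))) differentiable at (x i)" for x using g by (cases "i = k") auto
  show "\<exists>h. (h = (\<lambda>x. x k) \<or> (\<exists>c. h = (\<lambda>_. c))) \<and> (\<forall>x\<in>U. partial_deriv i g x = h x)"
    using g by (intro exI[of _ "\<lambda>_. if i = k \<and> g = (\<lambda>x. x k) then 1 else 0"]) (auto simp: partial_deriv_def)
qed auto


section \<open>The spaces above are diffeological spaces\<close>

text \<open>
  The record type \<open>diffeology\<close> does not enforce the axioms of \<^const>\<open>diffeological_space\<close>;
  here they are established for every construction.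
\<close>

lemma smooth_between_open_vimage:
  assumes "openin (Euclidean_space n) U" "openin (Euclidean_space m) V" "smooth_between m V n U f"
    "openin (Euclidean_space n) W"
  shows "openin (Euclidean_space m) {v \<in> V. f v \<in> W}"
proof -
  obtain T where T: "open T" "W = {x. \<forall>i\<ge>n. x i = 0} \<inter> T"
    using assms(4) unfolding Euclidean_space_eq openin_open by blast
  have "openin (top_of_set V) (V \<inter> f -` T)"
    using smooth_between_continuous[OF assms(1,3)] T(1) by (rule continuous_openin_preimage_gen)
  moreover have "V \<inter> f -` T = {v \<in> V. f v \<in> W}"
    using open_imp_points[OF assms(1)] assms(3) T(2) by (auto simp: smooth_between_def Pi_iff)
  ultimately have "openin (top_of_set V) {v \<in> V. f v \<in> W}" by simp
  then show ?thesis
    using assms(2) unfolding Euclidean_space_eq by (rule openin_trans)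
qed

lemma smooth_between_id:
  "openin (Euclidean_space n) V \<Longrightarrow> V \<subseteq> U \<Longrightarrow> smooth_between n V n U (\<lambda>x. x)"
  by (auto simp: smooth_between_def smooth_fun_coord)

lemma smooth_between_cong:
  assumes "openin (Euclidean_space m) V" "smooth_between m V n U f" "\<And>x. x \<in> V \<Longrightarrow> f x = g x"
  shows "smooth_between m V n U g"
  unfolding smooth_between_def
proof (intro conjI allI impI)
  show "g \<in> V \<rightarrow> U" using assms(2,3) by (auto simp: smooth_between_def Pi_iff)
  show "smooth_fun m V (\<lambda>x. g x i)" if "i < n" for i
    by (rule smooth_fun_cong[OF assms(1), of "\<lambda>x. f x i"])
      (use assms(2,3) that in \<open>auto simp: smooth_between_def\<close>)
qed

lemma smooth_between_comp:
  assumes "openin (Euclidean_space n) U" "openin (Euclidean_space m) V"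
    "smooth_between m V n U g" "smooth_between n U k W f"
  shows "smooth_between m V k W (\<lambda>x. f (g x))"
  unfolding smooth_between_def
proof (intro conjI allI impI)
  show "(\<lambda>x. f (g x)) \<in> V \<rightarrow> W" using assms(3,4) by (auto simp: smooth_between_def Pi_iff)
  show "smooth_fun m V (\<lambda>x. f (g x) i)" if "i < k" for i
    using smooth_fun_compose[OF assms(1-3), of "\<lambda>x. f x i"] assms(4) that
    by (auto simp: smooth_between_def)
qed

lemma smooth_between_subset:
  "smooth_between m V n U f \<Longrightarrow> W \<subseteq> V \<Longrightarrow> f \<in> W \<rightarrow> U' \<Longrightarrow> smooth_between m W n U' f"
  unfolding smooth_between_def using smooth_fun_subset[of m V _ W] by auto

lemma diffeological_spaceI:
  assumes "\<And>n U d. d \<in> plots X n U \<Longrightarrow> openin (Euclidean_space n) U"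
    "\<And>n U d. d \<in> plots X n U \<Longrightarrow> d \<in> U \<rightarrow>\<^sub>E points X"
    "\<And>n U x. x \<in> points X \<Longrightarrow> openin (Euclidean_space n) U \<Longrightarrow> (\<lambda>u\<in>U. x) \<in> plots X n U"
    "\<And>m V n U f d. d \<in> plots X n U \<Longrightarrow> openin (Euclidean_space n) U \<Longrightarrow> openin (Euclidean_space m) V \<Longrightarrow>
       smooth_between m V n U f \<Longrightarrow> f \<in> V \<rightarrow> U \<Longrightarrow> compose V d f \<in> plots X m V"
    "\<And>n U d. d \<in> U \<rightarrow>\<^sub>E points X \<Longrightarrow> openin (Euclidean_space n) U \<Longrightarrow>
       (\<And>u. u \<in> U \<Longrightarrow> \<exists>V. u \<in> V \<and> V \<subseteq> U \<and> openin (Euclidean_space n) V \<and> restrict d V \<in> plots X n V) \<Longrightarrow>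
       d \<in> plots X n U"
  shows "diffeological_space X"
  unfolding diffeological_space_def
proof (intro conjI allI ballI impI)
  fix m V n U f d
  assume *: "d \<in> plots X n U" "openin (Euclidean_space m) V \<and> smooth_between m V n U f"
  then show "compose V d f \<in> plots X m V"
    by (intro assms(4)[of d n U] assms(1)[OF *(1)]) (auto simp: smooth_between_def)
next
  show "openin (Euclidean_space n) U" "d \<in> U \<rightarrow>\<^sub>E points X" if "d \<in> plots X n U" for n U d
    using assms(1,2)[OF that] by auto
  show "(\<lambda>u\<in>U. x) \<in> plots X n U" if "x \<in> points X" "openin (Euclidean_space n) U" for n U x
    using assms(3)[OF that] .
  show "d \<in> plots X n U"
    if "d \<in> U \<rightarrow>\<^sub>E points X" "openin (Euclidean_space n) U \<and>
        (\<forall>u\<in>U. \<exists>V. u \<in> V \<and> V \<subseteq> U \<and> openin (Euclidean_space n) V \<and> restrict d V \<in> plots X n V)"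
    for n U d
    by (rule assms(5)) (use that in auto)
qed

lemma
  assumes "diffeological_space X"
  shows plot_open: "d \<in> plots X n U \<Longrightarrow> openin (Euclidean_space n) U"
    and plot_fun: "d \<in> plots X n U \<Longrightarrow> d \<in> U \<rightarrow>\<^sub>E points X"
    and plot_const: "x \<in> points X \<Longrightarrow> openin (Euclidean_space n) U \<Longrightarrow> (\<lambda>u\<in>U. x) \<in> plots X n U"
    and plot_compose: "d \<in> plots X n U \<Longrightarrow> openin (Euclidean_space m) V \<Longrightarrow>
       smooth_between m V n U f \<Longrightarrow> compose V d f \<in> plots X m V"
    and plot_local: "d \<in> U \<rightarrow>\<^sub>E points X \<Longrightarrow> openin (Euclidean_space n) U \<Longrightarrow>
       (\<And>u. u \<in> U \<Longrightarrow> \<exists>V. u \<in> V \<and> V \<subseteq> U \<and> openin (Euclidean_space n) V \<and> restrict d V \<in> plots X n V) \<Longrightarrow>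
       d \<in> plots X n U"
proof -
  note ax = assms[unfolded diffeological_space_def]
  note ax1 = conjunct1[OF ax] and ax2 = conjunct1[OF conjunct2[OF ax]]
    and ax3 = conjunct1[OF conjunct2[OF conjunct2[OF ax]]]
    and ax4 = conjunct2[OF conjunct2[OF conjunct2[OF ax]]]
  show "d \<in> plots X n U \<Longrightarrow> openin (Euclidean_space n) U"
    and "d \<in> plots X n U \<Longrightarrow> d \<in> U \<rightarrow>\<^sub>E points X"
    using ax1 by auto
  show "x \<in> points X \<Longrightarrow> openin (Euclidean_space n) U \<Longrightarrow> (\<lambda>u\<in>U. x) \<in> plots X n U"
    using ax2 by simp
  show "d \<in> plots X n U \<Longrightarrow> openin (Euclidean_space m) V \<Longrightarrow>
       smooth_between m V n U f \<Longrightarrow> compose V d f \<in> plots X m V"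
    using ax3 by simp
  show "d \<in> U \<rightarrow>\<^sub>E points X \<Longrightarrow> openin (Euclidean_space n) U \<Longrightarrow>
       (\<And>u. u \<in> U \<Longrightarrow> \<exists>V. u \<in> V \<and> V \<subseteq> U \<and> openin (Euclidean_space n) V \<and> restrict d V \<in> plots X n V) \<Longrightarrow>
       d \<in> plots X n U"
    using ax4[rule_format, of d U n] by simp
qed

lemma plot_restrict:
  assumes "diffeological_space X" "d \<in> plots X n U" "openin (Euclidean_space n) V" "V \<subseteq> U"
  shows "restrict d V \<in> plots X n V"
  using plot_compose[OF assms(1,2,3) smooth_between_id[OF assms(3,4)]] by (simp add: compose_def)

lemma diffeological_space_open:
  assumes "openin (Euclidean_space n) \<Omega>"
  shows "diffeological_space (open_diffeology n \<Omega>)"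
proof (rule diffeological_spaceI)
  fix m U x assume "x \<in> points (open_diffeology n \<Omega>)" "openin (Euclidean_space m) U"
  then show "(\<lambda>u\<in>U. x) \<in> plots (open_diffeology n \<Omega>) m U"
    using smooth_between_cong[of m U n \<Omega> "\<lambda>_. x" "\<lambda>u\<in>U. x"]
    by (simp add: open_diffeology_def smooth_between_def smooth_fun_const Pi_iff)
next
  fix m V k U f d
  assume *: "d \<in> plots (open_diffeology n \<Omega>) k U" "openin (Euclidean_space k) U"
    "openin (Euclidean_space m) V" "smooth_between m V k U f" "f \<in> V \<rightarrow> U"
  then have "smooth_between m V n \<Omega> (\<lambda>x. d (f x))"
    using smooth_between_comp[OF *(2-4)] by (simp add: open_diffeology_def)
  from smooth_between_cong[OF *(3) this, of "compose V d f"]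
  show "compose V d f \<in> plots (open_diffeology n \<Omega>) m V"
    using * by (auto simp: open_diffeology_def compose_def)
next
  fix m U d
  assume *: "d \<in> U \<rightarrow>\<^sub>E points (open_diffeology n \<Omega>)" "openin (Euclidean_space m) U"
    "\<And>u. u \<in> U \<Longrightarrow> \<exists>V. u \<in> V \<and> V \<subseteq> U \<and> openin (Euclidean_space m) V \<and>
       restrict d V \<in> plots (open_diffeology n \<Omega>) m V"
  have "smooth_fun m U (\<lambda>x. d x i)" if "i < n" for i
  proof (rule smooth_fun_local)
    fix u assume "u \<in> U"
    then obtain V where V: "u \<in> V" "V \<subseteq> U" "openin (Euclidean_space m) V"
      "smooth_between m V n \<Omega> (restrict d V)"
      using *(3)[of u] by (auto simp: open_diffeology_def)
    have "smooth_fun m V (\<lambda>x. d x i)"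
      by (rule smooth_fun_cong[OF V(3), of "\<lambda>x. restrict d V x i"])
        (use V(4) that in \<open>auto simp: smooth_between_def\<close>)
    with V show "\<exists>V. u \<in> V \<and> V \<subseteq> U \<and> openin (Euclidean_space m) V \<and> smooth_fun m V (\<lambda>x. d x i)"
      by blast
  qed
  then show "d \<in> plots (open_diffeology n \<Omega>) m U"
    using * by (auto simp: open_diffeology_def smooth_between_def)
qed (auto simp: open_diffeology_def)

lemma diffeological_space_real: "diffeological_space real_diffeology"
proof (rule diffeological_spaceI)
  fix m U and x :: real assume "x \<in> points real_diffeology" "openin (Euclidean_space m) U"
  then show "(\<lambda>u\<in>U. x) \<in> plots real_diffeology m U"
    using smooth_fun_cong[OF _ smooth_fun_const, of m U x "\<lambda>u\<in>U. x"]
    by (simp add: real_diffeology_def)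
next
  fix m V k U f d
  assume *: "d \<in> plots real_diffeology k U" "openin (Euclidean_space k) U"
    "openin (Euclidean_space m) V" "smooth_between m V k U f" "f \<in> V \<rightarrow> U"
  then have "smooth_fun m V (\<lambda>x. d (f x))"
    using smooth_fun_compose[OF *(2-4)] by (simp add: real_diffeology_def)
  from smooth_fun_cong[OF *(3) this, of "compose V d f"]
  show "compose V d f \<in> plots real_diffeology m V"
    using * by (auto simp: real_diffeology_def compose_def)
next
  fix m U d
  assume *: "d \<in> U \<rightarrow>\<^sub>E points real_diffeology" "openin (Euclidean_space m) U"
    "\<And>u. u \<in> U \<Longrightarrow> \<exists>V. u \<in> V \<and> V \<subseteq> U \<and> openin (Euclidean_space m) V \<and>
       restrict d V \<in> plots real_diffeology m V"
  have "smooth_fun m U d"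
  proof (rule smooth_fun_local)
    fix u assume "u \<in> U"
    then obtain V where V: "u \<in> V" "V \<subseteq> U" "openin (Euclidean_space m) V"
      "smooth_fun m V (restrict d V)"
      using *(3)[of u] by (auto simp: real_diffeology_def)
    have "smooth_fun m V d"
      by (rule smooth_fun_cong[OF V(3,4)]) auto
    with V show "\<exists>V. u \<in> V \<and> V \<subseteq> U \<and> openin (Euclidean_space m) V \<and> smooth_fun m V d"
      by blast
  qed
  then show "d \<in> plots real_diffeology m U"
    using * by (auto simp: real_diffeology_def PiE_iff)
qed (auto simp: real_diffeology_def extensional_def)

lemma diffeological_space_discrete: "diffeological_space (discrete_diffeology S)"
proof (rule diffeological_spaceI)
  fix m V k U f d
  assume *: "d \<in> plots (discrete_diffeology S) k U" "openin (Euclidean_space k) U"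
    "openin (Euclidean_space m) V" "smooth_between m V k U f" "f \<in> V \<rightarrow> U"
  have "\<exists>W. v \<in> W \<and> W \<subseteq> V \<and> openin (Euclidean_space m) W \<and> (\<forall>w\<in>W. compose V d f w = compose V d f v)"
    if "v \<in> V" for v
  proof -
    have "f v \<in> U" using *(5) that by auto
    moreover have "\<forall>u\<in>U. \<exists>V. u \<in> V \<and> V \<subseteq> U \<and> openin (Euclidean_space k) V \<and> (\<forall>v\<in>V. d v = d u)"
      using *(1) by (simp add: discrete_diffeology_def)
    ultimately obtain W where W: "f v \<in> W" "W \<subseteq> U" "openin (Euclidean_space k) W" "\<forall>w\<in>W. d w = d (f v)"
      by blast
    have "openin (Euclidean_space m) {v \<in> V. f v \<in> W}"
      by (rule smooth_between_open_vimage[OF *(2,3,4) W(3)])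
    moreover have "compose V d f w = compose V d f v" if "w \<in> V" "f w \<in> W" for w
      using bspec[OF W(4) that(2)] that(1) \<open>v \<in> V\<close> by (simp add: compose_eq)
    ultimately show ?thesis
      using W(1) that by (intro exI[of _ "{v \<in> V. f v \<in> W}"]) blast
  qed
  then show "compose V d f \<in> plots (discrete_diffeology S) m V"
    using * by (auto simp: discrete_diffeology_def compose_def)
next
  fix m U d
  assume *: "d \<in> U \<rightarrow>\<^sub>E points (discrete_diffeology S)" "openin (Euclidean_space m) U"
    "\<And>u. u \<in> U \<Longrightarrow> \<exists>V. u \<in> V \<and> V \<subseteq> U \<and> openin (Euclidean_space m) V \<and>
       restrict d V \<in> plots (discrete_diffeology S) m V"
  have "\<exists>V. u \<in> V \<and> V \<subseteq> U \<and> openin (Euclidean_space m) V \<and> (\<forall>v\<in>V. d v = d u)" if u: "u \<in> U" for u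
  proof -
    obtain V where V: "u \<in> V" "V \<subseteq> U" "restrict d V \<in> plots (discrete_diffeology S) m V"
      using *(3)[OF u] by blast
    have "\<forall>u\<in>V. \<exists>W. u \<in> W \<and> W \<subseteq> V \<and> openin (Euclidean_space m) W \<and>
        (\<forall>v\<in>W. restrict d V v = restrict d V u)"
      using V(3) unfolding discrete_diffeology_def diffeology.simps by blast
    then obtain W where W: "u \<in> W" "W \<subseteq> V" "openin (Euclidean_space m) W"
      "\<forall>v\<in>W. restrict d V v = restrict d V u"
      using V(1) by blast
    then have "\<forall>v\<in>W. d v = d u" using V(1) by (metis restrict_apply' subsetD)
    with W V(2) show ?thesis by blast
  qed
  then show "d \<in> plots (discrete_diffeology S) m U"
    using * by (auto simp: discrete_diffeology_def)
qed (auto simp: discrete_diffeology_def)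

lemma diffeological_space_prod:
  assumes X: "diffeological_space X" and Y: "diffeological_space Y"
  shows "diffeological_space (prod_diffeology X Y)"
proof (rule diffeological_spaceI)
  fix m U d assume "d \<in> plots (prod_diffeology X Y) m U"
  then show "openin (Euclidean_space m) U"
    using plot_open[OF X] by (auto simp: prod_diffeology_def)
next
  fix m U x assume *: "x \<in> points (prod_diffeology X Y)" "openin (Euclidean_space m) U"
  then have "(\<lambda>u\<in>U. fst x) \<in> plots X m U" "(\<lambda>u\<in>U. snd x) \<in> plots Y m U"
    by (auto simp: prod_diffeology_def intro!: plot_const[OF X] plot_const[OF Y])
  moreover have "compose U fst (\<lambda>u\<in>U. x) = (\<lambda>u\<in>U. fst x)" "compose U snd (\<lambda>u\<in>U. x) = (\<lambda>u\<in>U. snd x)"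
    by (auto simp: compose_def fun_eq_iff)
  ultimately show "(\<lambda>u\<in>U. x) \<in> plots (prod_diffeology X Y) m U"
    using * by (auto simp: prod_diffeology_def)
next
  fix m V k U f d
  assume *: "d \<in> plots (prod_diffeology X Y) k U" "openin (Euclidean_space k) U"
    "openin (Euclidean_space m) V" "smooth_between m V k U f" "f \<in> V \<rightarrow> U"
  have "compose V fst (compose V d f) = compose V (compose U fst d) f"
    "compose V snd (compose V d f) = compose V (compose U snd d) f"
    using *(5) by (auto simp: compose_def fun_eq_iff)
  moreover have "d \<in> U \<rightarrow> points X \<times> points Y" "compose U fst d \<in> plots X k U" "compose U snd d \<in> plots Y k U"
    using *(1) by (auto simp: prod_diffeology_def)
  moreover from this(1) *(5) have "compose V d f \<in> V \<rightarrow>\<^sub>E points X \<times> points Y"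
    by (auto simp: compose_def PiE_iff dest!: funcset_mem)
  ultimately show "compose V d f \<in> plots (prod_diffeology X Y) m V"
    using plot_compose[OF X _ *(3,4)] plot_compose[OF Y _ *(3,4)] by (simp add: prod_diffeology_def)
next
  fix m U d
  assume *: "d \<in> U \<rightarrow>\<^sub>E points (prod_diffeology X Y)" "openin (Euclidean_space m) U"
    "\<And>u. u \<in> U \<Longrightarrow> \<exists>V. u \<in> V \<and> V \<subseteq> U \<and> openin (Euclidean_space m) V \<and>
       restrict d V \<in> plots (prod_diffeology X Y) m V"
  have r: "compose V fst (restrict d V) = restrict (compose U fst d) V"
    "compose V snd (restrict d V) = restrict (compose U snd d) V" if "V \<subseteq> U" for V
    using that by (auto simp: compose_def fun_eq_iff)
  have loc: "\<exists>V. u \<in> V \<and> V \<subseteq> U \<and> openin (Euclidean_space m) V \<and>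
      restrict (compose U fst d) V \<in> plots X m V \<and> restrict (compose U snd d) V \<in> plots Y m V"
    if u: "u \<in> U" for u
  proof -
    obtain V where V: "u \<in> V" "V \<subseteq> U" "openin (Euclidean_space m) V"
      "restrict d V \<in> plots (prod_diffeology X Y) m V"
      using *(3)[OF u] by blast
    then have "compose V fst (restrict d V) \<in> plots X m V" "compose V snd (restrict d V) \<in> plots Y m V"
      by (auto simp: prod_diffeology_def)
    with V(1-3) show ?thesis unfolding r[OF V(2)] by blast
  qed
  have "compose U fst d \<in> plots X m U"
  proof (rule plot_local[OF X _ *(2)])
    show "compose U fst d \<in> U \<rightarrow>\<^sub>E points X"
      using *(1) by (auto simp: prod_diffeology_def PiE_iff Pi_iff compose_def)
    show "\<exists>V. u \<in> V \<and> V \<subseteq> U \<and> openin (Euclidean_space m) V \<and> restrict (compose U fst d) V \<in> plots X m V"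
      if "u \<in> U" for u
      using loc[OF that] by blast
  qed
  moreover have "compose U snd d \<in> plots Y m U"
  proof (rule plot_local[OF Y _ *(2)])
    show "compose U snd d \<in> U \<rightarrow>\<^sub>E points Y"
      using *(1) by (auto simp: prod_diffeology_def PiE_iff Pi_iff compose_def)
    show "\<exists>V. u \<in> V \<and> V \<subseteq> U \<and> openin (Euclidean_space m) V \<and> restrict (compose U snd d) V \<in> plots Y m V"
      if "u \<in> U" for u
      using loc[OF that] by blast
  qed
  ultimately show "d \<in> plots (prod_diffeology X Y) m U"
    using *(1) by (auto simp: prod_diffeology_def)
qed (auto simp: prod_diffeology_def)

lemma diffeological_space_sub:
  assumes X: "diffeological_space X" and A: "A \<subseteq> points X"
  shows "diffeological_space (sub_diffeology A X)"
proof (rule diffeological_spaceI)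
  fix m U d assume "d \<in> plots (sub_diffeology A X) m U"
  then show "openin (Euclidean_space m) U" "d \<in> U \<rightarrow>\<^sub>E points (sub_diffeology A X)"
    using plot_open[OF X, of d m U] plot_fun[OF X, of d m U] by (auto simp: sub_diffeology_def PiE_iff)
next
  fix m U x assume "x \<in> points (sub_diffeology A X)" "openin (Euclidean_space m) U"
  then show "(\<lambda>u\<in>U. x) \<in> plots (sub_diffeology A X) m U"
    using A by (auto simp: sub_diffeology_def intro: plot_const[OF X])
next
  fix m V k U f d
  assume *: "d \<in> plots (sub_diffeology A X) k U"
    "openin (Euclidean_space m) V" "smooth_between m V k U f" "f \<in> V \<rightarrow> U"
  then have "d \<in> plots X k U" "d \<in> U \<rightarrow> A" by (auto simp: sub_diffeology_def)
  then show "compose V d f \<in> plots (sub_diffeology A X) m V"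
    using plot_compose[OF X _ *(2,3)] *(4) by (auto simp: sub_diffeology_def compose_def)
next
  fix m U d
  assume *: "d \<in> U \<rightarrow>\<^sub>E points (sub_diffeology A X)" "openin (Euclidean_space m) U"
    "\<And>u. u \<in> U \<Longrightarrow> \<exists>V. u \<in> V \<and> V \<subseteq> U \<and> openin (Euclidean_space m) V \<and>
       restrict d V \<in> plots (sub_diffeology A X) m V"
  have "d \<in> plots X m U"
  proof (rule plot_local[OF X _ *(2)])
    show "d \<in> U \<rightarrow>\<^sub>E points X" using *(1) A by (auto simp: sub_diffeology_def PiE_iff)
    show "\<exists>V. u \<in> V \<and> V \<subseteq> U \<and> openin (Euclidean_space m) V \<and> restrict d V \<in> plots X m V"
      if "u \<in> U" for u
      using *(3)[OF that] unfolding sub_diffeology_def by auto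
  qed
  then show "d \<in> plots (sub_diffeology A X) m U"
    using *(1) by (auto simp: sub_diffeology_def)
qed

lemma diffeological_space_quotient:
  assumes X: "diffeological_space X"
  shows "diffeological_space (quotient_diffeology X r)"
proof (rule diffeological_spaceI)
  fix m U x assume *: "x \<in> points (quotient_diffeology X r)" "openin (Euclidean_space m) U"
  then obtain a where a: "a \<in> points X" "x = r `` {a}" by (auto simp: quotient_diffeology_def quotient_def)
  have "\<exists>V. u \<in> V \<and> V \<subseteq> U \<and> openin (Euclidean_space m) V \<and>
      (\<exists>e\<in>plots X m V. \<forall>v\<in>V. (\<lambda>u\<in>U. x) v = r `` {e v})" if "u \<in> U" for u
    using that * a plot_const[OF X a(1) *(2)]
    by (intro exI[of _ U]) (auto intro!: bexI[of _ "\<lambda>u\<in>U. a"])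
  then show "(\<lambda>u\<in>U. x) \<in> plots (quotient_diffeology X r) m U"
    using * by (auto simp: quotient_diffeology_def)
next
  fix m V k U f d
  assume *: "d \<in> plots (quotient_diffeology X r) k U" "openin (Euclidean_space k) U"
    "openin (Euclidean_space m) V" "smooth_between m V k U f" "f \<in> V \<rightarrow> U"
  have "\<exists>W. v \<in> W \<and> W \<subseteq> V \<and> openin (Euclidean_space m) W \<and>
      (\<exists>e\<in>plots X m W. \<forall>w\<in>W. compose V d f w = r `` {e w})" if v: "v \<in> V" for v
  proof -
    have fv: "f v \<in> U" using v *(5) by auto
    have "\<forall>u\<in>U. \<exists>V. u \<in> V \<and> V \<subseteq> U \<and> openin (Euclidean_space k) V \<and>
        (\<exists>e\<in>plots X k V. \<forall>v\<in>V. d v = r `` {e v})"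
      using *(1) by (simp add: quotient_diffeology_def)
    from bspec[OF this fv] obtain W where W: "f v \<in> W" "W \<subseteq> U" "openin (Euclidean_space k) W"
      and ex: "\<exists>e\<in>plots X k W. \<forall>w\<in>W. d w = r `` {e w}"
      by (elim exE conjE)
    from ex obtain e where e: "e \<in> plots X k W" "\<And>w. w \<in> W \<Longrightarrow> d w = r `` {e w}"
      by blast
    define W' where "W' = {v \<in> V. f v \<in> W}"
    have o: "openin (Euclidean_space m) W'"
      unfolding W'_def by (rule smooth_between_open_vimage[OF *(2,3,4) W(3)])
    have "smooth_between m W' k W f"
      by (rule smooth_between_subset[OF *(4)]) (auto simp: W'_def)
    then have "compose W' e f \<in> plots X m W'"
      by (rule plot_compose[OF X e(1) o])
    moreover have "compose V d f w = r `` {compose W' e f w}" if "w \<in> W'" for w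
      using that e(2)[of "f w"] by (simp add: W'_def compose_eq)
    moreover have "v \<in> W'" "W' \<subseteq> V" using v W(1) by (auto simp: W'_def)
    ultimately show ?thesis using o by (intro exI[of _ W'] conjI bexI[of _ "compose W' e f"]) auto
  qed
  then show "compose V d f \<in> plots (quotient_diffeology X r) m V"
    using * by (auto simp: quotient_diffeology_def compose_def)
next
  fix m U d
  assume *: "d \<in> U \<rightarrow>\<^sub>E points (quotient_diffeology X r)" "openin (Euclidean_space m) U"
    "\<And>u. u \<in> U \<Longrightarrow> \<exists>V. u \<in> V \<and> V \<subseteq> U \<and> openin (Euclidean_space m) V \<and>
       restrict d V \<in> plots (quotient_diffeology X r) m V"
  have "\<exists>V. u \<in> V \<and> V \<subseteq> U \<and> openin (Euclidean_space m) V \<and>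
      (\<exists>e\<in>plots X m V. \<forall>v\<in>V. d v = r `` {e v})" if u: "u \<in> U" for u
  proof -
    obtain V where V: "u \<in> V" "V \<subseteq> U" "restrict d V \<in> plots (quotient_diffeology X r) m V"
      using *(3)[OF u] by blast
    have "\<forall>u\<in>V. \<exists>W. u \<in> W \<and> W \<subseteq> V \<and> openin (Euclidean_space m) W \<and>
        (\<exists>e\<in>plots X m W. \<forall>v\<in>W. restrict d V v = r `` {e v})"
      using V(3) by (simp add: quotient_diffeology_def)
    from bspec[OF this V(1)] obtain W where W: "u \<in> W" "W \<subseteq> V" "openin (Euclidean_space m) W"
      and ex: "\<exists>e\<in>plots X m W. \<forall>v\<in>W. restrict d V v = r `` {e v}"
      by (elim exE conjE)
    have "\<exists>e\<in>plots X m W. \<forall>v\<in>W. d v = r `` {e v}"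
      using ex W(2) by (metis restrict_apply' subsetD)
    with W V(2) show ?thesis by (intro exI[of _ W]) auto
  qed
  then show "d \<in> plots (quotient_diffeology X r) m U"
    using * by (auto simp: quotient_diffeology_def)
qed (auto simp: quotient_diffeology_def)

lemma smooth_map_plot: "smooth_map X Y f \<Longrightarrow> d \<in> plots X n U \<Longrightarrow> compose U f d \<in> plots Y n U"
  by (simp add: smooth_map_def)

lemma functional_plotD:
  assumes "d \<in> plots (functional_diffeology X Y) n U"
  shows "openin (Euclidean_space n) U" "d \<in> U \<rightarrow>\<^sub>E smooth_maps X Y"
    "smooth_map (prod_diffeology (open_diffeology n U) X) Y (\<lambda>(u, x). d u x)"
  using assms by (simp_all add: functional_diffeology_def)

lemma functional_plotI:
  assumes Y: "diffeological_space Y"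
    and d: "d \<in> U \<rightarrow>\<^sub>E smooth_maps X Y" "openin (Euclidean_space n) U"
    and pl: "\<And>k W p q. p \<in> plots (open_diffeology n U) k W \<Longrightarrow> q \<in> plots X k W \<Longrightarrow>
       p \<in> W \<rightarrow> U \<Longrightarrow> q \<in> W \<rightarrow> points X \<Longrightarrow> (\<lambda>w\<in>W. d (p w) (q w)) \<in> plots Y k W"
  shows "d \<in> plots (functional_diffeology X Y) n U"
proof -
  have "smooth_map (prod_diffeology (open_diffeology n U) X) Y (\<lambda>(u, x). d u x)"
    unfolding smooth_map_def
  proof (intro conjI allI ballI)
    have "d u x \<in> points Y" if "u \<in> U" "x \<in> points X" for u x
    proof -
      have "d u \<in> smooth_maps X Y" using d(1) that(1) by auto
      then show ?thesis using that(2) by (auto simp: smooth_maps_def smooth_map_def)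
    qed
    then show "(\<lambda>(u, x). d u x) \<in> points (prod_diffeology (open_diffeology n U) X) \<rightarrow> points Y"
      by (simp add: prod_diffeology_def open_diffeology_def Pi_iff)
  next
    fix k W e assume "e \<in> plots (prod_diffeology (open_diffeology n U) X) k W"
    then have e: "compose W fst e \<in> plots (open_diffeology n U) k W" "compose W snd e \<in> plots X k W"
      "e \<in> W \<rightarrow> U \<times> points X"
      by (auto simp: prod_diffeology_def open_diffeology_def)
    have "(\<lambda>w\<in>W. d (compose W fst e w) (compose W snd e w)) \<in> plots Y k W"
      using e(3) by (intro pl e(1,2)) (auto simp: compose_def Pi_iff mem_Times_iff)
    moreover have "(\<lambda>w\<in>W. d (compose W fst e w) (compose W snd e w)) = compose W (\<lambda>(u, x). d u x) e"
      by (auto simp: compose_def fun_eq_iff split_beta)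
    ultimately show "compose W (\<lambda>(u, x). d u x) e \<in> plots Y k W" by simp
  qed
  then show ?thesis using d by (simp add: functional_diffeology_def)
qed

lemma functional_plot_eval:
  assumes d: "d \<in> plots (functional_diffeology X Y) n U"
    and p: "p \<in> plots (open_diffeology n U) k W" and q: "q \<in> plots X k W" "q \<in> W \<rightarrow>\<^sub>E points X"
  shows "(\<lambda>w\<in>W. d (p w) (q w)) \<in> plots Y k W"
proof -
  have p': "p \<in> W \<rightarrow>\<^sub>E U" using p by (simp add: open_diffeology_def)
  define e where "e = (\<lambda>w\<in>W. (p w, q w))"
  have e: "compose W fst e = p" "compose W snd e = q"
  proof -
    have "compose W fst e w = p w \<and> compose W snd e w = q w" for w
      using PiE_arb[OF p', of w] PiE_arb[OF q(2), of w]
      by (cases "w \<in> W") (simp_all add: e_def compose_def)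
    then show "compose W fst e = p" "compose W snd e = q" by blast+
  qed
  have "e \<in> W \<rightarrow>\<^sub>E U \<times> points X"
    using PiE_mem[OF p'] PiE_mem[OF q(2)] by (simp add: e_def)
  moreover have "points (open_diffeology n U) = U" by (simp add: open_diffeology_def)
  moreover note p q(1)
  ultimately have "e \<in> plots (prod_diffeology (open_diffeology n U) X) k W"
    unfolding prod_diffeology_def by (simp add: e)
  from smooth_map_plot[OF functional_plotD(3)[OF d] this]
  have "compose W (\<lambda>(u, x). d u x) e \<in> plots Y k W" .
  moreover have "compose W (\<lambda>(u, x). d u x) e = (\<lambda>w\<in>W. d (p w) (q w))"
    by (auto simp: e_def compose_def fun_eq_iff)
  ultimately show ?thesis by simp
qed

lemma diffeological_space_functional:
  assumes X: "diffeological_space X" and Y: "diffeological_space Y"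
  shows "diffeological_space (functional_diffeology X Y)"
proof (rule diffeological_spaceI)
  fix n U d assume d: "d \<in> plots (functional_diffeology X Y) n U"
  show "openin (Euclidean_space n) U" by (rule functional_plotD(1)[OF d])
  show "d \<in> U \<rightarrow>\<^sub>E points (functional_diffeology X Y)"
    using functional_plotD(2)[OF d] by (simp add: functional_diffeology_def)
next
  fix n U f assume f: "f \<in> points (functional_diffeology X Y)" and U: "openin (Euclidean_space n) U"
  then have fs: "f \<in> smooth_maps X Y" by (simp add: functional_diffeology_def)
  show "(\<lambda>u\<in>U. f) \<in> plots (functional_diffeology X Y) n U"
  proof (rule functional_plotI[OF Y _ U])
    show "(\<lambda>u\<in>U. f) \<in> U \<rightarrow>\<^sub>E smooth_maps X Y" using fs by auto
    fix k W p q assume *: "p \<in> plots (open_diffeology n U) k W" "q \<in> plots X k W" "p \<in> W \<rightarrow> U"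
    have "compose W f q \<in> plots Y k W"
      using fs smooth_map_plot[OF _ *(2), of Y f] unfolding smooth_maps_def by blast
    moreover have "compose W f q = (\<lambda>w\<in>W. (\<lambda>u\<in>U. f) (p w) (q w))"
      using *(3) by (auto simp: compose_def fun_eq_iff Pi_iff)
    ultimately show "(\<lambda>w\<in>W. (\<lambda>u\<in>U. f) (p w) (q w)) \<in> plots Y k W" by simp
  qed
next
  fix m V n U f d
  assume d: "d \<in> plots (functional_diffeology X Y) n U" and U: "openin (Euclidean_space n) U"
    and V: "openin (Euclidean_space m) V" and f: "smooth_between m V n U f" "f \<in> V \<rightarrow> U"
  show "compose V d f \<in> plots (functional_diffeology X Y) m V"
  proof (rule functional_plotI[OF Y _ V])
    show "compose V d f \<in> V \<rightarrow>\<^sub>E smooth_maps X Y"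
      using functional_plotD(2)[OF d] f(2) by (auto simp: compose_def)
    fix k W p q assume *: "p \<in> plots (open_diffeology m V) k W" "q \<in> plots X k W" "p \<in> W \<rightarrow> V"
    have W: "openin (Euclidean_space k) W" and p: "smooth_between k W m V p"
      using *(1) by (auto simp: open_diffeology_def)
    have "smooth_between k W n U (\<lambda>w. f (p w))"
      by (rule smooth_between_comp[OF V W p f(1)])
    then have "smooth_between k W n U (\<lambda>w\<in>W. f (p w))"
      by (rule smooth_between_cong[OF W]) simp
    then have "(\<lambda>w\<in>W. f (p w)) \<in> plots (open_diffeology n U) k W"
      using W *(3) f(2) by (auto simp: open_diffeology_def)
    from functional_plot_eval[OF d this *(2) plot_fun[OF X *(2)]]
    have "(\<lambda>w\<in>W. d ((\<lambda>w\<in>W. f (p w)) w) (q w)) \<in> plots Y k W" .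
    moreover have "(\<lambda>w\<in>W. d ((\<lambda>w\<in>W. f (p w)) w) (q w)) = (\<lambda>w\<in>W. compose V d f (p w) (q w))"
      using *(3) by (auto simp: compose_def fun_eq_iff Pi_iff)
    ultimately show "(\<lambda>w\<in>W. compose V d f (p w) (q w)) \<in> plots Y k W" by simp
  qed
next
  fix n U d
  assume d: "d \<in> U \<rightarrow>\<^sub>E points (functional_diffeology X Y)" and U: "openin (Euclidean_space n) U"
    and loc: "\<And>u. u \<in> U \<Longrightarrow> \<exists>V. u \<in> V \<and> V \<subseteq> U \<and> openin (Euclidean_space n) V \<and>
       restrict d V \<in> plots (functional_diffeology X Y) n V"
  have d': "d \<in> U \<rightarrow>\<^sub>E smooth_maps X Y" using d by (simp add: functional_diffeology_def)
  show "d \<in> plots (functional_diffeology X Y) n U"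
  proof (rule functional_plotI[OF Y d' U])
    fix k W p q assume *: "p \<in> plots (open_diffeology n U) k W" "q \<in> plots X k W"
      "p \<in> W \<rightarrow> U" "q \<in> W \<rightarrow> points X"
    have W: "openin (Euclidean_space k) W" and p: "smooth_between k W n U p"
      using *(1) by (auto simp: open_diffeology_def)
    show "(\<lambda>w\<in>W. d (p w) (q w)) \<in> plots Y k W"
    proof (rule plot_local[OF Y _ W])
      have "d (p w) (q w) \<in> points Y" if "w \<in> W" for w
      proof -
        have "d (p w) \<in> smooth_maps X Y" "q w \<in> points X" using d' *(3,4) that by auto
        then show ?thesis by (auto simp: smooth_maps_def smooth_map_def)
      qed
      then show "(\<lambda>w\<in>W. d (p w) (q w)) \<in> W \<rightarrow>\<^sub>E points Y" by simp
      fix w assume w: "w \<in> W"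
      then have "p w \<in> U" using *(3) by auto
      from loc[OF this] obtain V where V: "p w \<in> V" "V \<subseteq> U" "openin (Euclidean_space n) V"
        "restrict d V \<in> plots (functional_diffeology X Y) n V"
        by (elim exE conjE)
      define W' where "W' = {w \<in> W. p w \<in> V}"
      have W': "openin (Euclidean_space k) W'" "W' \<subseteq> W" "w \<in> W'"
        using smooth_between_open_vimage[OF U W p V(3)] w V(1) by (auto simp: W'_def)
      have "smooth_between k W' n V p"
        by (rule smooth_between_subset[OF p W'(2)]) (auto simp: W'_def)
      then have "smooth_between k W' n V (restrict p W')"
        by (rule smooth_between_cong[OF W'(1)]) simp
      then have p': "restrict p W' \<in> plots (open_diffeology n V) k W'"
        using W'(1) by (auto simp: open_diffeology_def W'_def)
      have q': "restrict q W' \<in> plots X k W'"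
        by (rule plot_restrict[OF X *(2) W'(1,2)])
      from functional_plot_eval[OF V(4) p' q' plot_fun[OF X q']]
      have "(\<lambda>w\<in>W'. restrict d V (restrict p W' w) (restrict q W' w)) \<in> plots Y k W'" .
      moreover have "(\<lambda>w\<in>W'. restrict d V (restrict p W' w) (restrict q W' w)) =
          restrict (\<lambda>w\<in>W. d (p w) (q w)) W'"
        by (auto simp: W'_def fun_eq_iff)
      ultimately show "\<exists>V. w \<in> V \<and> V \<subseteq> W \<and> openin (Euclidean_space k) V \<and>
          restrict (\<lambda>w\<in>W. d (p w) (q w)) V \<in> plots Y k V"
        using W' by (intro exI[of _ W']) simp
    qed
  qed
qed

lemma smooth_maps_open_real:
  assumes "openin (Euclidean_space n) \<Omega>"
  shows "smooth_maps (open_diffeology n \<Omega>) real_diffeology = {f \<in> extensional \<Omega>. smooth_fun n \<Omega> f}"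
proof (intro equalityI subsetI CollectI conjI)
  fix f assume f: "f \<in> smooth_maps (open_diffeology n \<Omega>) real_diffeology"
  then show "f \<in> extensional \<Omega>" by (simp add: smooth_maps_def open_diffeology_def)
  have "smooth_between n \<Omega> n \<Omega> (\<lambda>x\<in>\<Omega>. x)"
    by (rule smooth_between_cong[OF assms smooth_between_id[OF assms order_refl]]) simp
  then have "(\<lambda>x\<in>\<Omega>. x) \<in> plots (open_diffeology n \<Omega>) n \<Omega>"
    using assms by (simp add: open_diffeology_def)
  then have "compose \<Omega> f (\<lambda>x\<in>\<Omega>. x) \<in> plots real_diffeology n \<Omega>"
    using f smooth_map_plot[of "open_diffeology n \<Omega>" real_diffeology f] unfolding smooth_maps_def by blast
  then have "smooth_fun n \<Omega> (compose \<Omega> f (\<lambda>x\<in>\<Omega>. x))" by (simp add: real_diffeology_def)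
  then show "smooth_fun n \<Omega> f" by (rule smooth_fun_cong[OF assms]) (simp add: compose_def)
next
  fix f assume "f \<in> {f \<in> extensional \<Omega>. smooth_fun n \<Omega> f}"
  then have f: "f \<in> extensional \<Omega>" "smooth_fun n \<Omega> f" by auto
  have "compose U f d \<in> plots real_diffeology m U" if "d \<in> plots (open_diffeology n \<Omega>) m U" for m U d
  proof -
    have d: "openin (Euclidean_space m) U" "smooth_between m U n \<Omega> d"
      using that by (auto simp: open_diffeology_def)
    have "smooth_fun m U (compose U f d)"
      by (rule smooth_fun_cong[OF d(1) smooth_fun_compose[OF assms d f(2)]]) (simp add: compose_def)
    then show ?thesis using d(1) by (simp add: real_diffeology_def)
  qed
  then show "f \<in> smooth_maps (open_diffeology n \<Omega>) real_diffeology"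
    using f(1) by (simp add: smooth_maps_def smooth_map_def open_diffeology_def real_diffeology_def)
qed

lemma smooth_maps_discrete:
  assumes Y: "diffeological_space Y"
  shows "smooth_maps (discrete_diffeology S) Y = S \<rightarrow>\<^sub>E points Y"
proof (intro equalityI subsetI)
  fix f assume f: "f \<in> S \<rightarrow>\<^sub>E points Y"
  have "compose U f d \<in> plots Y n U" if d: "d \<in> plots (discrete_diffeology S) n U" for n U d
  proof (rule plot_local[OF Y])
    have d': "d \<in> U \<rightarrow>\<^sub>E S" using d by (simp add: discrete_diffeology_def)
    then show "compose U f d \<in> U \<rightarrow>\<^sub>E points Y" using f by (auto simp: compose_def)
    show "openin (Euclidean_space n) U" using d by (simp add: discrete_diffeology_def)
    fix u assume u: "u \<in> U"
    have "\<forall>u\<in>U. \<exists>V. u \<in> V \<and> V \<subseteq> U \<and> openin (Euclidean_space n) V \<and> (\<forall>v\<in>V. d v = d u)"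
      using d by (simp add: discrete_diffeology_def)
    from bspec[OF this u] obtain V where V: "u \<in> V" "V \<subseteq> U" "openin (Euclidean_space n) V"
      "\<forall>v\<in>V. d v = d u" by (elim exE conjE)
    have "(\<lambda>v\<in>V. f (d u)) \<in> plots Y n V"
      using d' u f by (intro plot_const[OF Y _ V(3)]) auto
    moreover have "restrict (compose U f d) V v = (\<lambda>v\<in>V. f (d u)) v" for v
      using V(2) bspec[OF V(4), of v] by (cases "v \<in> V") (auto simp: compose_eq subset_iff)
    then have "restrict (compose U f d) V = (\<lambda>v\<in>V. f (d u))" by (rule ext)
    ultimately show "\<exists>V. u \<in> V \<and> V \<subseteq> U \<and> openin (Euclidean_space n) V \<and>
        restrict (compose U f d) V \<in> plots Y n V"
      using V(1-3) by (intro exI[of _ V]) simp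
  qed
  then show "f \<in> smooth_maps (discrete_diffeology S) Y"
    using f by (simp add: smooth_maps_def smooth_map_def PiE_iff Pi_iff) (simp add: discrete_diffeology_def)
next
  fix f assume "f \<in> smooth_maps (discrete_diffeology S) Y"
  then show "f \<in> S \<rightarrow>\<^sub>E points Y"
    by (simp add: smooth_maps_def smooth_map_def discrete_diffeology_def PiE_iff Pi_iff)
qed

lemma diffeological_space_smooth_functions:
  "openin (Euclidean_space n) \<Omega> \<Longrightarrow> diffeological_space (smooth_functions_space n \<Omega>)"
  unfolding smooth_functions_space_def
  by (intro diffeological_space_functional diffeological_space_open diffeological_space_real)

lemma points_functional [simp]: "points (functional_diffeology X Y) = smooth_maps X Y"
  by (simp add: functional_diffeology_def)

lemma diffeological_space_special_colombeau:
  assumes "openin (Euclidean_space n) \<Omega>"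
  shows "diffeological_space (special_colombeau n \<Omega>)"
proof -
  have Y: "diffeological_space (smooth_functions_space n \<Omega>)"
    using assms by (rule diffeological_space_smooth_functions)
  have "diffeological_space (moderate_funs_space n \<Omega>)" unfolding moderate_funs_space_def
    by (intro diffeological_space_sub diffeological_space_functional diffeological_space_discrete Y)
      (auto simp: smooth_maps_discrete[OF Y] moderate_funs_def)
  then show ?thesis unfolding special_colombeau_def by (rule diffeological_space_quotient)
qed

lemma diffeological_space_generalized_points:
  assumes "openin (Euclidean_space n) \<Omega>"
  shows "diffeological_space (generalized_points n \<Omega>)"
proof -
  have Y: "diffeological_space (open_diffeology n \<Omega>)"
    using assms by (rule diffeological_space_open)
  have "points (open_diffeology n \<Omega>) = \<Omega>" by (simp add: open_diffeology_def)
  then have "diffeological_space (moderate_points_space n \<Omega>)" unfolding moderate_points_space_def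
    by (intro diffeological_space_sub diffeological_space_functional diffeological_space_discrete Y)
      (auto simp: smooth_maps_discrete[OF Y] moderate_points_def)
  then show ?thesis unfolding generalized_points_def by (rule diffeological_space_quotient)
qed

lemma diffeological_space_generalized_reals: "diffeological_space generalized_reals"
proof -
  have Y: "diffeological_space real_diffeology" by (rule diffeological_space_real)
  have "points real_diffeology = UNIV" by (simp add: real_diffeology_def)
  then have "diffeological_space moderate_reals_space" unfolding moderate_reals_space_def
    by (intro diffeological_space_sub diffeological_space_functional diffeological_space_discrete Y)
      (auto simp: smooth_maps_discrete[OF Y] moderate_reals_def)
  then show ?thesis unfolding generalized_reals_def by (rule diffeological_space_quotient)
qed

lemma compact_points_subset: "compact_points \<Omega> \<subseteq> moderate_points n \<Omega>"
proof
  fix x assume "x \<in> compact_points \<Omega>"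
  then obtain K \<epsilon>0 where x: "x \<in> eps_set \<rightarrow>\<^sub>E \<Omega>" and K: "compact K" and e: "\<epsilon>0 > 0"
    and xK: "\<And>\<epsilon>. \<epsilon> \<in> eps_set \<Longrightarrow> \<epsilon> < \<epsilon>0 \<Longrightarrow> x \<epsilon> \<in> K"
    unfolding compact_points_def by blast
  have "continuous_on K (\<lambda>x. L2_set x {..<n})"
    unfolding L2_set_def by (intro continuous_intros continuous_on_product_then_coordinatewise)
  then have "bounded ((\<lambda>x. L2_set x {..<n}) ` K)"
    using K by (intro compact_imp_bounded compact_continuous_image)
  then obtain B where B: "\<And>x. x \<in> K \<Longrightarrow> \<bar>L2_set x {..<n}\<bar> \<le> B"
    by (auto simp: bounded_iff)
  have "eventually (\<lambda>\<epsilon>. norm (L2_set (x \<epsilon>) {..<n}) \<le> B * norm (1 / \<epsilon> ^ 0)) (at_right 0)"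
    using eventually_at_right_real[of 0 "min 1 \<epsilon>0"] e
    by (auto elim!: eventually_mono intro!: order_trans[OF abs_ge_self B] xK)
  then have "moderate_net (\<lambda>\<epsilon>. L2_set (x \<epsilon>) {..<n})"
    unfolding moderate_net_def by (blast intro: bigoI)
  then show "x \<in> moderate_points n \<Omega>" using x by (simp add: moderate_points_def)
qed

lemma diffeological_space_compact_generalized_points:
  assumes "openin (Euclidean_space n) \<Omega>"
  shows "diffeological_space (compact_generalized_points n \<Omega>)"
  unfolding compact_generalized_points_def
proof (rule diffeological_space_sub[OF diffeological_space_generalized_points[OF assms]])
  show "compact_points \<Omega> // point_rel n \<Omega> \<subseteq> points (generalized_points n \<Omega>)"
    using compact_points_subset[of \<Omega> n]
    by (auto simp: generalized_points_def quotient_diffeology_def moderate_points_space_def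
        sub_diffeology_def quotient_def)
qed

end

theory Submission
  imports Defs
begin

text \<open>
  A compactly supported generalized point stays, for small \<open>\<epsilon>\<close>, in a compact set \<open>K\<close>, and every
  representative of it stays in a compact neighbourhood \<open>K'\<close> of \<open>K\<close> that contains the segments
  between the two representatives.  The mean value theorem bounds \<open>u\<^sub>\<epsilon>(y\<^sub>\<epsilon>) - u\<^sub>\<epsilon>(x\<^sub>\<epsilon>)\<close> by
  \<open>|y\<^sub>\<epsilon> - x\<^sub>\<epsilon>|\<close> times the first derivatives of \<open>u\<^sub>\<epsilon>\<close> on \<open>K'\<close>, that is, negligible times moderate,
  so evaluation does not depend on the representatives.  In particular the local lifts of a plot
  of \<open>\<Omega>\<^sub>c / \<sim>\<close> to moderate points are themselves compactly supported.  Hence the evaluation of local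
  lifts is a local lift of the evaluated plot, and it is a plot by composition of smooth functions.
\<close>

section \<open>Compact neighbourhoods and the mean value theorem\<close>

text \<open>Tychonoff: the box is a product of closed intervals. Intervals of zero length are
  allowed, which later confines boxes to \<open>Euclidean_space n\<close>.\<close>

lemma compact_box: "compact {y :: nat \<Rightarrow> real. \<forall>i. a i \<le> y i \<and> y i \<le> b i}"
proof -
  have "compactin (product_topology (\<lambda>i. euclidean) UNIV) (PiE UNIV (\<lambda>i. {a i..b i}))"
    by (simp add: compactin_PiE)
  moreover have "PiE UNIV (\<lambda>i. {a i..b i}) = {y. \<forall>i. a i \<le> y i \<and> y i \<le> b i}"
    by (auto simp: PiE_iff)
  ultimately show ?thesis by (simp add: euclidean_product_topology)
qed

text \<open>Around each point of K an open box of radius r fits into U. Finitely many boxes of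
  radius r/3 cover K; the closed boxes of radius 2r/3 still lie in U and leave room r/3 for a
  segment starting in K. The union of the closed boxes is the required compact set.\<close>

lemma compact_segment_neighbourhood:
  assumes U: "openin (Euclidean_space n) U" and K: "compact K" "K \<subseteq> U"
  obtains K' \<delta> where "compact K'" "K' \<subseteq> U" "\<delta> > 0"
    "\<And>x y t. x \<in> K \<Longrightarrow> (\<forall>i<n. \<bar>y i - x i\<bar> < \<delta>) \<Longrightarrow> (\<forall>i\<ge>n. y i = 0) \<Longrightarrow>
       0 \<le> t \<Longrightarrow> t \<le> 1 \<Longrightarrow> (\<lambda>i. x i + t * (y i - x i)) \<in> K'"
proof -
  have "\<exists>r>0. \<forall>y. (\<forall>i<n. \<bar>y i - c i\<bar> < r) \<longrightarrow> (\<forall>i\<ge>n. y i = 0) \<longrightarrow> y \<in> U" if "c \<in> K" for c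
    using open_box[OF U, of c] that K(2) by (metis subsetD)
  then obtain r where r: "\<And>c. c \<in> K \<Longrightarrow> r c > 0"
    "\<And>c y. c \<in> K \<Longrightarrow> (\<forall>i<n. \<bar>y i - c i\<bar> < r c) \<Longrightarrow> (\<forall>i\<ge>n. y i = 0) \<Longrightarrow> y \<in> U"
    by metis
  \<comment> \<open>Only the first n coordinates are constrained, so \<open>B c\<close> is open in
    the product topology on \<open>nat \<Rightarrow> real\<close>, where compactness of K is
    stated.\<close>
  define B where "B c = {y. \<forall>i\<in>{..<n}. \<bar>y i - c i\<bar> < r c / 3}" for c
  have B: "B c = (\<Inter>i\<in>{..<n}. {y. \<bar>y i - c i\<bar> < r c / 3})" for c by (auto simp: B_def)
  have "open (B c)" for c unfolding B
    by (intro open_INT ballI open_Collect_less continuous_intros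
        continuous_on_product_then_coordinatewise) auto
  moreover have "K \<subseteq> (\<Union>c\<in>K. B c)" using r(1) by (force simp: B_def)
  ultimately obtain C where C: "C \<subseteq> K" "finite C" "K \<subseteq> (\<Union>c\<in>C. B c)"
    using compactE_image[OF K(1), of K B] by metis
  \<comment> \<open>Width 0 from index n on forces these coordinates to agree with those of c, which
    vanish.\<close>
  define R where "R c i = (if i < n then 2 * r c / 3 else 0)" for c i
  define B' where "B' c = {y. \<forall>i. c i - R c i \<le> y i \<and> y i \<le> c i + R c i}" for c
  \<comment> \<open>The inserted 1 keeps \<open>Min\<close> meaningful when K, and with it C, is
    empty.\<close>
  define \<delta> where "\<delta> = Min (insert 1 ((\<lambda>c. r c / 3) ` C))"
  have le: "\<delta> \<le> r c / 3" if "c \<in> C" for c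
    unfolding \<delta>_def using C(2) that by (intro Min_le) auto
  show thesis
  proof (rule that[of "\<Union>c\<in>C. B' c" \<delta>])
    show "compact (\<Union>c\<in>C. B' c)"
      using C(2) unfolding B'_def by (intro compact_UN compact_box)
    show "\<delta> > 0" unfolding \<delta>_def using C(1,2) r(1) by auto
    show "(\<Union>c\<in>C. B' c) \<subseteq> U"
    proof
      fix y assume "y \<in> (\<Union>c\<in>C. B' c)"
      then obtain c where c: "c \<in> C" "\<And>i. c i - R c i \<le> y i \<and> y i \<le> c i + R c i"
        by (auto simp: B'_def)
      have cK: "c \<in> K" using c(1) C(1) by auto
      show "y \<in> U"
      proof (rule r(2)[OF cK])
        show "\<forall>i<n. \<bar>y i - c i\<bar> < r c"
        proof (intro allI impI)
          fix i assume "i < n"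
          then show "\<bar>y i - c i\<bar> < r c" using c(2)[of i] r(1)[OF cK] unfolding R_def abs_less_iff by auto
        qed
        show "\<forall>i\<ge>n. y i = 0"
        proof (intro allI impI)
          fix i assume "i \<ge> n"
          then show "y i = 0" using c(2)[of i] open_imp_points[OF U, of c i] cK K(2) by (auto simp: R_def)
        qed
      qed
    qed
    fix x y :: point and t :: real
    assume *: "x \<in> K" "\<forall>i<n. \<bar>y i - x i\<bar> < \<delta>" "\<forall>i\<ge>n. y i = 0" "0 \<le> t" "t \<le> 1"
    from *(1) C(3) obtain c where c: "c \<in> C" "x \<in> B c" by auto
    \<comment> \<open>The distance to c is at most r/3 from x being in \<open>B c\<close> plus r/3
      from the step along the segment.\<close>
    have "c i - R c i \<le> x i + t * (y i - x i) \<and> x i + t * (y i - x i) \<le> c i + R c i" for i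
    proof (cases "i < n")
      case True
      have "\<bar>t * (y i - x i)\<bar> \<le> 1 * \<bar>y i - x i\<bar>"
        unfolding abs_mult using *(4,5) by (intro mult_right_mono) auto
      also have "\<dots> < r c / 3" using *(2)[rule_format, OF True] le[OF c(1)] by simp
      finally have "\<bar>t * (y i - x i)\<bar> < r c / 3" .
      moreover have "\<bar>x i - c i\<bar> < r c / 3" using c(2) True by (simp add: B_def)
      ultimately show ?thesis using True unfolding R_def abs_less_iff by auto
    next
      case False
      have "x \<in> U" "c \<in> U" using *(1) c(1) C(1) K(2) by auto
      then show ?thesis
        using *(3) False open_imp_points[OF U, of x i] open_imp_points[OF U, of c i]
        by (simp add: R_def)
    qed
    then show "(\<lambda>i. x i + t * (y i - x i)) \<in> (\<Union>c\<in>C. B' c)"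
      using c(1) by (auto simp: B'_def)
  qed
qed

text \<open>The one-variable mean value theorem for f along the segment, whose derivative the chain
  rule expresses by the partial derivatives of f.\<close>

lemma smooth_fun_mean_value:
  assumes U: "openin (Euclidean_space n) U" and f: "smooth_fun n U f"
    and seg: "\<And>t. 0 \<le> t \<Longrightarrow> t \<le> 1 \<Longrightarrow> (\<lambda>i. x i + t * (y i - x i)) \<in> U"
  shows "\<exists>t. 0 < t \<and> t < 1 \<and>
    f y - f x = (\<Sum>i<n. (y i - x i) * partial_deriv i f (\<lambda>i. x i + t * (y i - x i)))"
proof -
  define \<gamma> where "\<gamma> t = (\<lambda>i. x i + t * (y i - x i))" for t
  \<comment> \<open>The endpoints t = 0 and t = 1 show that x and y, hence the whole line through
    them, vanish from index n on, as the chain rule demands.\<close>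
  have "x \<in> U" "y \<in> U" using seg[of 0] seg[of 1] by simp_all
  then have z: "\<gamma> t i = 0" if "i \<ge> n" for t i
    using open_imp_points[OF U \<open>x \<in> U\<close> that] open_imp_points[OF U \<open>y \<in> U\<close> that]
    by (simp add: \<gamma>_def)
  have "DERIV (\<lambda>t. f (\<gamma> t)) t :> (\<Sum>i<n. (y i - x i) * partial_deriv i f (\<gamma> t))"
    if "0 \<le> t" "t \<le> 1" for t
  proof (rule chain_rule_curve[OF U f])
    show "\<gamma> t \<in> U" using seg[OF that] by (simp add: \<gamma>_def)
    show "DERIV (\<lambda>t. \<gamma> t i) t :> y i - x i" for i
      unfolding \<gamma>_def by (auto intro!: derivative_eq_intros)
  qed (rule z)
  from MVT2[of 0 1, OF _ this] obtain t where "0 < t" "t < 1"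
    "f (\<gamma> 1) - f (\<gamma> 0) = (\<Sum>i<n. (y i - x i) * partial_deriv i f (\<gamma> t))"
    by auto
  moreover have "\<gamma> 1 = y" "\<gamma> 0 = x" by (auto simp: \<gamma>_def)
  ultimately show ?thesis by (auto simp: \<gamma>_def)
qed

section \<open>Derivatives with multi-indices\<close>

lemma smooth_fun_multi_deriv:
  assumes "smooth_fun n U f"
  shows "smooth_fun n U (multi_deriv n \<alpha> f)"
proof -
  have pow: "smooth_fun n U ((partial_deriv i ^^ k) g)" if "smooth_fun n U g" "i < n" for i k g
    by (induction k) (use that in \<open>auto intro: smooth_fun_partial\<close>)
  have "smooth_fun n U (foldr (\<lambda>i. partial_deriv i ^^ \<alpha> i) js f)" if "set js \<subseteq> {..<n}" for js
    using that by (induction js) (auto intro: pow assms)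
  then show ?thesis by (simp add: multi_deriv_def atLeast0LessThan)
qed

text \<open>Identifies order zero in the growth conditions with the function values
  themselves.\<close>

lemma multi_deriv_zero: "multi_deriv n (\<lambda>_. 0) f = f"
proof -
  have "foldr (\<lambda>i. partial_deriv i ^^ 0) js f = f" for js by (induction js) auto
  then show ?thesis by (simp add: multi_deriv_def)
qed

text \<open>Identifies the unit multi-indices with the first derivatives in the mean value
  theorem.\<close>

lemma multi_deriv_single:
  assumes "i < n"
  shows "multi_deriv n (\<lambda>j. of_bool (j = i)) f = partial_deriv i f"
proof -
  \<comment> \<open>Distinctness ensures that the derivative in direction i is taken only
    once.\<close>
  have "distinct js \<Longrightarrow> foldr (\<lambda>j. partial_deriv j ^^ of_bool (j = i)) js f =
      (if i \<in> set js then partial_deriv i f else f)" for js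
    by (induction js) auto
  from this[of "[0..<n]"] show ?thesis using assms by (simp add: multi_deriv_def)
qed

text \<open>A real supremum is an upper bound only for sets bounded above; here continuity on the
  compact K provides the bound.\<close>

lemma abs_multi_deriv_le_SUP:
  assumes "smooth_fun n U f" "compact K" "K \<subseteq> U" "x \<in> K"
  shows "\<bar>multi_deriv n \<alpha> f x\<bar> \<le> (SUP x\<in>K. \<bar>multi_deriv n \<alpha> f x\<bar>)"
proof (rule cSUP_upper[OF assms(4)])
  have "continuous_on K (\<lambda>x. \<bar>multi_deriv n \<alpha> f x\<bar>)"
    using smooth_fun_continuous[OF smooth_fun_multi_deriv[OF assms(1)]] assms(3)
    by (intro continuous_intros) (rule continuous_on_subset)
  then show "bdd_above ((\<lambda>x. \<bar>multi_deriv n \<alpha> f x\<bar>) ` K)"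
    using assms(2) by (intro bounded_imp_bdd_above compact_imp_bounded compact_continuous_image)
qed

text \<open>Partial derivatives depend only on values near the point, so f may be arbitrary outside
  U. This applies to the extensional zero function, which is \<open>undefined\<close> there.\<close>

lemma multi_deriv_eq_0:
  assumes U: "openin (Euclidean_space n) U" and f: "\<And>x. x \<in> U \<Longrightarrow> f x = 0" and x: "x \<in> U"
  shows "multi_deriv n \<alpha> f x = 0"
proof -
  have pow: "\<forall>x\<in>U. (partial_deriv i ^^ k) g x = 0" if "\<forall>x\<in>U. g x = 0" "i < n" for i k g
  proof (induction k)
    case (Suc k)
    have "partial_deriv i ((partial_deriv i ^^ k) g) x = partial_deriv i (\<lambda>_. 0) x" if "x \<in> U" for x
      using Suc by (intro partial_deriv_cong[OF U that \<open>i < n\<close>]) auto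
    then show ?case by (simp add: partial_deriv_def[of i "\<lambda>_. 0"])
  qed (use that in auto)
  have "\<forall>x\<in>U. foldr (\<lambda>i. partial_deriv i ^^ \<alpha> i) js f x = 0" if "set js \<subseteq> {..<n}" for js
    using that f by (induction js) (auto intro: pow[rule_format])
  then show ?thesis using x by (simp add: multi_deriv_def atLeast0LessThan)
qed

section \<open>Moderate and negligible nets\<close>

lemma eventually_eps: "eventually (\<lambda>\<epsilon>. \<epsilon> \<in> eps_set) (at_right 0)"
  using eventually_at_right_real[of 0 1] by (auto elim: eventually_mono)

lemma moderate_net_abs [simp]: "moderate_net (\<lambda>\<epsilon>. \<bar>a \<epsilon>\<bar>) = moderate_net a"
  by (simp add: moderate_net_def)

lemma negligible_net_abs [simp]: "negligible_net (\<lambda>\<epsilon>. \<bar>a \<epsilon>\<bar>) = negligible_net a"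
  by (simp add: negligible_net_def)

lemma eventually_abs_le_imp_bigo:
  fixes a b :: "real \<Rightarrow> real"
  assumes "eventually (\<lambda>\<epsilon>. \<bar>a \<epsilon>\<bar> \<le> b \<epsilon>) F"
  shows "a \<in> O[F](b)"
  by (rule bigoI[of _ 1]) (use assms in \<open>auto elim: eventually_mono\<close>)

lemma moderate_net_mono:
  assumes "moderate_net b" "eventually (\<lambda>\<epsilon>. \<bar>a \<epsilon>\<bar> \<le> b \<epsilon>) (at_right 0)"
  shows "moderate_net a"
  using assms landau_o.big_trans[OF eventually_abs_le_imp_bigo[OF assms(2)]]
  unfolding moderate_net_def by blast

lemma negligible_net_mono:
  assumes "negligible_net b" "eventually (\<lambda>\<epsilon>. \<bar>a \<epsilon>\<bar> \<le> b \<epsilon>) (at_right 0)"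
  shows "negligible_net a"
  using assms landau_o.big_trans[OF eventually_abs_le_imp_bigo[OF assms(2)]]
  unfolding negligible_net_def by blast

lemma negligible_net_zero: "negligible_net (\<lambda>_. 0)"
  by (simp add: negligible_net_def)

lemma negligible_net_add:
  "negligible_net a \<Longrightarrow> negligible_net b \<Longrightarrow> negligible_net (\<lambda>\<epsilon>. a \<epsilon> + b \<epsilon>)"
  by (simp add: negligible_net_def sum_in_bigo)

lemma negligible_net_minus: "negligible_net a \<Longrightarrow> negligible_net (\<lambda>\<epsilon>. - a \<epsilon>)"
  by (simp add: negligible_net_def)

lemma negligible_net_sum:
  "(\<And>i. i \<in> A \<Longrightarrow> negligible_net (a i)) \<Longrightarrow> negligible_net (\<lambda>\<epsilon>. \<Sum>i\<in>A. a i \<epsilon>)"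
  unfolding negligible_net_def by (auto intro: big_sum_in_bigo)

lemma negligible_net_mult_moderate:
  assumes "negligible_net a" "moderate_net b"
  shows "negligible_net (\<lambda>\<epsilon>. a \<epsilon> * b \<epsilon>)"
  unfolding negligible_net_def
proof
  fix m :: nat
  obtain N where N: "b \<in> O[at_right 0](\<lambda>\<epsilon>. 1 / \<epsilon> ^ N)"
    using assms(2) unfolding moderate_net_def by blast
  \<comment> \<open>The N extra powers absorb the growth of b.\<close>
  have a: "a \<in> O[at_right 0](\<lambda>\<epsilon>. \<epsilon> ^ (m + N))"
    using assms(1) unfolding negligible_net_def by blast
  have "eventually (\<lambda>\<epsilon>::real. \<epsilon> ^ (m + N) * (1 / \<epsilon> ^ N) = \<epsilon> ^ m) (at_right 0)"
    using eventually_eps by eventually_elim (simp add: power_add)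
  from landau_o.big.cong[OF this] landau_o.big_mult[OF a N]
  show "(\<lambda>\<epsilon>. a \<epsilon> * b \<epsilon>) \<in> O[at_right 0](\<lambda>\<epsilon>. \<epsilon> ^ m)" by simp
qed

lemma negligible_net_tendsto_0:
  assumes "negligible_net a"
  shows "(a \<longlongrightarrow> 0) (at_right 0)"
proof -
  \<comment> \<open>Order one already forces convergence to 0.\<close>
  have "a \<in> O[at_right 0](\<lambda>\<epsilon>. \<epsilon> ^ 1)" using assms unfolding negligible_net_def by blast
  then obtain c where "eventually (\<lambda>\<epsilon>. norm (a \<epsilon>) \<le> c * norm (\<epsilon> ^ 1)) (at_right 0)"
    by (auto elim!: landau_o.bigE)
  moreover have "((\<lambda>\<epsilon>::real. c * norm (\<epsilon> ^ 1)) \<longlongrightarrow> c * norm ((0::real) ^ 1)) (at_right 0)"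
    by (intro tendsto_intros)
  ultimately show ?thesis by (intro Lim_null_comparison[of a]) auto
qed

section \<open>Equivalence of representatives\<close>

lemma equiv_real_rel: "equiv moderate_reals real_rel"
proof (rule equivI)
  show "sym real_rel"
    by (rule symI) (auto simp: real_rel_def dest: negligible_net_minus)
  show "trans real_rel"
  proof (rule transI)
    fix a b c assume "(a, b) \<in> real_rel" "(b, c) \<in> real_rel"
    then show "(a, c) \<in> real_rel"
      using negligible_net_add[of "\<lambda>\<epsilon>. a \<epsilon> - b \<epsilon>" "\<lambda>\<epsilon>. b \<epsilon> - c \<epsilon>"] by (auto simp: real_rel_def)
  qed
qed (auto simp: real_rel_def refl_on_def negligible_net_zero)

lemma point_rel_refl: "x \<in> moderate_points n \<Omega> \<Longrightarrow> (x, x) \<in> point_rel n \<Omega>"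
  by (simp add: point_rel_def L2_set_0' negligible_net_zero)

lemma moderate_fun_smooth:
  assumes "openin (Euclidean_space n) \<Omega>" "u \<in> moderate_funs n \<Omega>" "\<epsilon> \<in> eps_set"
  shows "smooth_fun n \<Omega> (u \<epsilon>)"
  using assms(2,3) smooth_maps_open_real[OF assms(1)]
  by (auto simp: moderate_funs_def smooth_functions_space_def)

lemma negligible_fun_smooth:
  assumes "openin (Euclidean_space n) \<Omega>" "u \<in> negligible_funs n \<Omega>" "\<epsilon> \<in> eps_set"
  shows "smooth_fun n \<Omega> (u \<epsilon>)"
  using assms(2,3) smooth_maps_open_real[OF assms(1)]
  by (auto simp: negligible_funs_def smooth_functions_space_def)

text \<open>Puts u into its own class, so that classes of moderate nets are nonempty.\<close>

lemma fun_rel_refl: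
  assumes \<Omega>: "openin (Euclidean_space n) \<Omega>" and u: "u \<in> moderate_funs n \<Omega>"
  shows "(u, u) \<in> fun_rel n \<Omega>"
proof -
  have "smooth_fun n \<Omega> (\<lambda>x\<in>\<Omega>. 0)"
    by (rule smooth_fun_cong[OF \<Omega> smooth_fun_const[OF \<Omega>, of 0]]) simp
  then have z: "(\<lambda>x\<in>\<Omega>. 0) \<in> points (smooth_functions_space n \<Omega>)"
    by (simp add: smooth_functions_space_def smooth_maps_open_real[OF \<Omega>])
  have "negligible_net (\<lambda>\<epsilon>. SUP x\<in>K. \<bar>multi_deriv n \<alpha> ((\<lambda>\<epsilon>\<in>eps_set. \<lambda>x\<in>\<Omega>. 0) \<epsilon>) x\<bar>)"
    if "K \<subseteq> \<Omega>" "K \<noteq> {}" for K \<alpha>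
  proof (rule negligible_net_mono[OF negligible_net_zero])
    \<comment> \<open>All derivatives vanish on K, and the supremum of the constant 0 is 0 because K
      is nonempty.\<close>
    have "(SUP x\<in>K. \<bar>multi_deriv n \<alpha> (\<lambda>x\<in>\<Omega>. 0) x\<bar>) = (SUP x\<in>K. 0)"
      using that(1) by (intro SUP_cong) (auto intro!: multi_deriv_eq_0[OF \<Omega>])
    then show "eventually (\<lambda>\<epsilon>. \<bar>SUP x\<in>K. \<bar>multi_deriv n \<alpha> ((\<lambda>\<epsilon>\<in>eps_set. \<lambda>x\<in>\<Omega>. 0) \<epsilon>) x\<bar>\<bar> \<le> 0) (at_right 0)"
      by (intro eventually_mono[OF eventually_eps]) (simp add: that(2))
  qed
  then have "(\<lambda>\<epsilon>\<in>eps_set. \<lambda>x\<in>\<Omega>. 0) \<in> negligible_funs n \<Omega>"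
    using z by (auto simp: negligible_funs_def)
  then show ?thesis using u by (simp add: fun_rel_def cong: restrict_cong)
qed

section \<open>Compactly supported points and their equivalent representatives\<close>

lemma compact_pointsE:
  assumes "x \<in> compact_points \<Omega>"
  obtains K where "compact K" "K \<subseteq> \<Omega>" "eventually (\<lambda>\<epsilon>. x \<epsilon> \<in> K) (at_right 0)"
proof -
  obtain K e where K: "compact K" "K \<subseteq> \<Omega>" "e > 0" "\<And>\<epsilon>. \<epsilon> \<in> eps_set \<Longrightarrow> \<epsilon> < e \<Longrightarrow> x \<epsilon> \<in> K"
    using assms unfolding compact_points_def by blast
  have "eventually (\<lambda>\<epsilon>. x \<epsilon> \<in> K) (at_right 0)"
    using eventually_eps eventually_at_right_real[OF K(3)]
    by eventually_elim (auto intro: K(4))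
  with K(1,2) show thesis by (rule that)
qed

lemma compact_pointsI:
  assumes "x \<in> eps_set \<rightarrow>\<^sub>E \<Omega>" "compact K" "K \<subseteq> \<Omega>" "eventually (\<lambda>\<epsilon>. x \<epsilon> \<in> K) (at_right 0)"
  shows "x \<in> compact_points \<Omega>"
proof -
  obtain e where "e > 0" "\<And>\<epsilon>. 0 < \<epsilon> \<Longrightarrow> \<epsilon> < e \<Longrightarrow> x \<epsilon> \<in> K"
    using assms(4) unfolding eventually_at_right_field by auto
  then have "\<forall>\<epsilon>\<in>eps_set. \<epsilon> < e \<longrightarrow> x \<epsilon> \<in> K" by simp
  with \<open>e > 0\<close> show ?thesis using assms(1-3) unfolding compact_points_def by blast
qed

text \<open>Each coordinate is dominated by the Euclidean norm.\<close>

lemma point_rel_coordinate: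
  assumes "(x, y) \<in> point_rel n \<Omega>" "i < n"
  shows "negligible_net (\<lambda>\<epsilon>. y \<epsilon> i - x \<epsilon> i)"
proof (rule negligible_net_mono)
  show "negligible_net (\<lambda>\<epsilon>. L2_set (\<lambda>i. x \<epsilon> i - y \<epsilon> i) {..<n})"
    using assms(1) by (simp add: point_rel_def)
  have "\<bar>y \<epsilon> i - x \<epsilon> i\<bar> \<le> L2_set (\<lambda>i. x \<epsilon> i - y \<epsilon> i) {..<n}" for \<epsilon>
    \<comment> \<open>Inserting absolute values makes the component bound two-sided; the squares in
      the norm remove them again.\<close>
    using member_le_L2_set[of "{..<n}" i "\<lambda>i. \<bar>x \<epsilon> i - y \<epsilon> i\<bar>"] assms(2)
    by (simp add: L2_set_def abs_minus_commute)
  then show "eventually (\<lambda>\<epsilon>. \<bar>y \<epsilon> i - x \<epsilon> i\<bar> \<le> L2_set (\<lambda>i. x \<epsilon> i - y \<epsilon> i) {..<n}) (at_right 0)"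
    by simp
qed

text \<open>Negligible differences tend to 0, so all n coordinates eventually differ by less than
  the \<delta> of the compact neighbourhood. One K then serves all small \<epsilon>.\<close>

lemma point_rel_segment:
  assumes \<Omega>: "openin (Euclidean_space n) \<Omega>" and x: "x \<in> compact_points \<Omega>"
    and xy: "(x, y) \<in> point_rel n \<Omega>"
  obtains K where "compact K" "K \<subseteq> \<Omega>"
    "eventually (\<lambda>\<epsilon>. \<forall>t. 0 \<le> t \<and> t \<le> 1 \<longrightarrow> (\<lambda>i. x \<epsilon> i + t * (y \<epsilon> i - x \<epsilon> i)) \<in> K) (at_right 0)"
proof -
  obtain K0 where K0: "compact K0" "K0 \<subseteq> \<Omega>" "eventually (\<lambda>\<epsilon>. x \<epsilon> \<in> K0) (at_right 0)"
    using x by (rule compact_pointsE)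
  obtain K \<delta> where K: "compact K" "K \<subseteq> \<Omega>" "\<delta> > 0"
    "\<And>x y t. x \<in> K0 \<Longrightarrow> (\<forall>i<n. \<bar>y i - x i\<bar> < \<delta>) \<Longrightarrow> (\<forall>i\<ge>n. y i = 0) \<Longrightarrow>
       0 \<le> t \<Longrightarrow> t \<le> 1 \<Longrightarrow> (\<lambda>i. x i + t * (y i - x i)) \<in> K"
    using compact_segment_neighbourhood[OF \<Omega> K0(1,2)] by blast
  have "eventually (\<lambda>\<epsilon>. \<forall>i\<in>{..<n}. \<bar>y \<epsilon> i - x \<epsilon> i\<bar> < \<delta>) (at_right 0)"
    using tendstoD[OF negligible_net_tendsto_0[OF point_rel_coordinate[OF xy]] K(3)]
    by (intro eventually_ball_finite) auto
  with K0(3) eventually_eps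
  have "eventually (\<lambda>\<epsilon>. \<forall>t. 0 \<le> t \<and> t \<le> 1 \<longrightarrow> (\<lambda>i. x \<epsilon> i + t * (y \<epsilon> i - x \<epsilon> i)) \<in> K) (at_right 0)"
  proof eventually_elim
    case (elim \<epsilon>)
    have "y \<epsilon> \<in> \<Omega>" using xy elim(2) by (auto simp: point_rel_def moderate_points_def)
    show ?case
    proof (intro allI impI)
      fix t :: real assume t: "0 \<le> t \<and> t \<le> 1"
      show "(\<lambda>i. x \<epsilon> i + t * (y \<epsilon> i - x \<epsilon> i)) \<in> K"
      proof (rule K(4)[OF elim(1)])
        show "\<forall>i<n. \<bar>y \<epsilon> i - x \<epsilon> i\<bar> < \<delta>" using elim(3) by simp
        show "\<forall>i\<ge>n. y \<epsilon> i = 0" using open_imp_points[OF \<Omega> \<open>y \<epsilon> \<in> \<Omega>\<close>] by simp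
      qed (use t in auto)
    qed
  qed
  with K(1,2) show thesis by (rule that)
qed

text \<open>The end t = 1 of the segment is the second representative.\<close>

lemma point_rel_compact_points:
  assumes \<Omega>: "openin (Euclidean_space n) \<Omega>" and x: "x \<in> compact_points \<Omega>"
    and xy: "(x, y) \<in> point_rel n \<Omega>"
  shows "y \<in> compact_points \<Omega>"
proof -
  obtain K where K: "compact K" "K \<subseteq> \<Omega>"
    "eventually (\<lambda>\<epsilon>. \<forall>t. 0 \<le> t \<and> t \<le> 1 \<longrightarrow> (\<lambda>i. x \<epsilon> i + t * (y \<epsilon> i - x \<epsilon> i)) \<in> K) (at_right 0)"
    using point_rel_segment[OF assms] by blast
  show ?thesis
  proof (rule compact_pointsI[OF _ K(1,2)])
    show "y \<in> eps_set \<rightarrow>\<^sub>E \<Omega>" using xy by (simp add: point_rel_def moderate_points_def)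
    show "eventually (\<lambda>\<epsilon>. y \<epsilon> \<in> K) (at_right 0)"
      using K(3) by eventually_elim (auto dest: spec[of _ 1])
  qed
qed

section \<open>Estimates for values of nets at compactly supported points\<close>

lemma moderate_fun_SUP:
  fixes x :: "real \<Rightarrow> point"
  assumes "u \<in> moderate_funs n \<Omega>" "compact K" "K \<subseteq> \<Omega>" "eventually (\<lambda>\<epsilon>. x \<epsilon> \<in> K) (at_right 0)"
  shows "moderate_net (\<lambda>\<epsilon>. SUP x\<in>K. \<bar>multi_deriv n \<alpha> (u \<epsilon>) x\<bar>)"
  \<comment> \<open>The net x visits K at least once, so K is nonempty as
    \<open>moderate_funs\<close> requires.\<close>
  using assms(1-3) eventually_happens'[OF trivial_limit_at_right_real assms(4)] by (auto simp: moderate_funs_def)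

text \<open>Once the points lie in K, the values are dominated by the supremum of order zero over
  K.\<close>

lemma moderate_fun_eval:
  assumes \<Omega>: "openin (Euclidean_space n) \<Omega>" and u: "u \<in> moderate_funs n \<Omega>"
    and x: "x \<in> compact_points \<Omega>"
  shows "(\<lambda>\<epsilon>\<in>eps_set. u \<epsilon> (x \<epsilon>)) \<in> moderate_reals"
proof -
  obtain K where K: "compact K" "K \<subseteq> \<Omega>" "eventually (\<lambda>\<epsilon>. x \<epsilon> \<in> K) (at_right 0)"
    using x by (rule compact_pointsE)
  have "eventually (\<lambda>\<epsilon>. \<bar>(\<lambda>\<epsilon>\<in>eps_set. u \<epsilon> (x \<epsilon>)) \<epsilon>\<bar> \<le>
      (SUP x\<in>K. \<bar>multi_deriv n (\<lambda>_. 0) (u \<epsilon>) x\<bar>)) (at_right 0)"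
    using eventually_eps K(3)
  proof eventually_elim
    case (elim \<epsilon>)
    then show ?case
      using abs_multi_deriv_le_SUP[OF moderate_fun_smooth[OF \<Omega> u elim(1)] K(1,2) elim(2), of "\<lambda>_. 0"]
      by (simp add: multi_deriv_zero)
  qed
  from moderate_net_mono[OF moderate_fun_SUP[OF u K] this]
  show ?thesis unfolding moderate_reals_def moderate_net_abs by (intro CollectI conjI) auto
qed

text \<open>Controls a change of the representative of the function; the bound is again the supremum
  of order zero.\<close>

lemma negligible_fun_eval:
  assumes \<Omega>: "openin (Euclidean_space n) \<Omega>" and u: "u \<in> negligible_funs n \<Omega>"
    and x: "x \<in> compact_points \<Omega>"
  shows "negligible_net (\<lambda>\<epsilon>. u \<epsilon> (x \<epsilon>))"
proof -
  obtain K where K: "compact K" "K \<subseteq> \<Omega>" "eventually (\<lambda>\<epsilon>. x \<epsilon> \<in> K) (at_right 0)"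
    using x by (rule compact_pointsE)
  have "negligible_net (\<lambda>\<epsilon>. SUP x\<in>K. \<bar>multi_deriv n (\<lambda>_. 0) (u \<epsilon>) x\<bar>)"
    using u K(1,2) eventually_happens'[OF trivial_limit_at_right_real K(3)] by (auto simp: negligible_funs_def)
  moreover have "eventually (\<lambda>\<epsilon>. \<bar>u \<epsilon> (x \<epsilon>)\<bar> \<le>
      (SUP x\<in>K. \<bar>multi_deriv n (\<lambda>_. 0) (u \<epsilon>) x\<bar>)) (at_right 0)"
    using eventually_eps K(3)
  proof eventually_elim
    case (elim \<epsilon>)
    then show ?case
      using abs_multi_deriv_le_SUP[OF negligible_fun_smooth[OF \<Omega> u elim(1)] K(1,2) elim(2), of "\<lambda>_. 0"]
      by (simp add: multi_deriv_zero)
  qed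
  ultimately show ?thesis by (rule negligible_net_mono)
qed

text \<open>Controls a change of the representative of the point: each summand in the mean value
  theorem is a negligible coordinate difference times a moderate derivative.\<close>

lemma moderate_fun_eval_diff:
  assumes \<Omega>: "openin (Euclidean_space n) \<Omega>" and u: "u \<in> moderate_funs n \<Omega>"
    and x: "x \<in> compact_points \<Omega>" and xy: "(x, y) \<in> point_rel n \<Omega>"
  shows "negligible_net (\<lambda>\<epsilon>. u \<epsilon> (y \<epsilon>) - u \<epsilon> (x \<epsilon>))"
proof -
  define seg where "seg \<epsilon> t = (\<lambda>i. x \<epsilon> i + t * (y \<epsilon> i - x \<epsilon> i))" for \<epsilon> t
  obtain K where K: "compact K" "K \<subseteq> \<Omega>"
    "eventually (\<lambda>\<epsilon>. \<forall>t. 0 \<le> t \<and> t \<le> 1 \<longrightarrow> seg \<epsilon> t \<in> K) (at_right 0)"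
    using point_rel_segment[OF \<Omega> x xy] unfolding seg_def by blast
  \<comment> \<open>Taking the supremum over K removes the dependence on the intermediate point,
    which varies with \<epsilon>.\<close>
  define S where "S i \<epsilon> = (SUP z\<in>K. \<bar>multi_deriv n (\<lambda>j. of_bool (j = i)) (u \<epsilon>) z\<bar>)" for i \<epsilon>
  \<comment> \<open>The start of the segment is the witness that K is nonempty.\<close>
  have "eventually (\<lambda>\<epsilon>. seg \<epsilon> 0 \<in> K) (at_right 0)"
    using K(3) by eventually_elim simp
  then have S: "moderate_net (S i)" for i
    unfolding S_def by (rule moderate_fun_SUP[OF u K(1,2)])
  show ?thesis
  proof (rule negligible_net_mono)
    show "negligible_net (\<lambda>\<epsilon>. \<Sum>i<n. \<bar>y \<epsilon> i - x \<epsilon> i\<bar> * S i \<epsilon>)"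
      using point_rel_coordinate[OF xy]
      by (intro negligible_net_sum negligible_net_mult_moderate S) simp
    show "eventually (\<lambda>\<epsilon>. \<bar>u \<epsilon> (y \<epsilon>) - u \<epsilon> (x \<epsilon>)\<bar> \<le> (\<Sum>i<n. \<bar>y \<epsilon> i - x \<epsilon> i\<bar> * S i \<epsilon>)) (at_right 0)"
      using eventually_eps K(3)
    proof eventually_elim
      case (elim \<epsilon>)
      have sm: "smooth_fun n \<Omega> (u \<epsilon>)" using moderate_fun_smooth[OF \<Omega> u elim(1)] .
      have "seg \<epsilon> t \<in> \<Omega>" if "0 \<le> t" "t \<le> 1" for t
        using elim(2) that K(2) by blast
      then obtain t where t: "0 < t" "t < 1"
        "u \<epsilon> (y \<epsilon>) - u \<epsilon> (x \<epsilon>) = (\<Sum>i<n. (y \<epsilon> i - x \<epsilon> i) * partial_deriv i (u \<epsilon>) (seg \<epsilon> t))"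
        using smooth_fun_mean_value[OF \<Omega> sm, of "x \<epsilon>" "y \<epsilon>"] unfolding seg_def by blast
      have "\<bar>partial_deriv i (u \<epsilon>) (seg \<epsilon> t)\<bar> \<le> S i \<epsilon>" if "i < n" for i
        using abs_multi_deriv_le_SUP[OF sm K(1,2), of "seg \<epsilon> t" "\<lambda>j. of_bool (j = i)"] elim(2) t(1,2)
        unfolding S_def multi_deriv_single[OF that] by simp
      then show ?case
        unfolding t(3) by (intro order_trans[OF sum_abs] sum_mono) (auto simp: abs_mult mult_left_mono)
    qed
  qed
qed

lemma eval_real_rel:
  assumes \<Omega>: "openin (Euclidean_space n) \<Omega>" and uv: "(u, v) \<in> fun_rel n \<Omega>"
    and x: "x \<in> compact_points \<Omega>" and xy: "(x, y) \<in> point_rel n \<Omega>"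
  shows "(\<lambda>\<epsilon>\<in>eps_set. u \<epsilon> (x \<epsilon>), \<lambda>\<epsilon>\<in>eps_set. v \<epsilon> (y \<epsilon>)) \<in> real_rel"
proof -
  have u: "u \<in> moderate_funs n \<Omega>" and v: "v \<in> moderate_funs n \<Omega>"
    and d: "(\<lambda>\<epsilon>\<in>eps_set. \<lambda>x\<in>\<Omega>. u \<epsilon> x - v \<epsilon> x) \<in> negligible_funs n \<Omega>"
    using uv by (auto simp: fun_rel_def)
  have y: "y \<in> compact_points \<Omega>" using point_rel_compact_points[OF \<Omega> x xy] .
  have y\<Omega>: "y \<epsilon> \<in> \<Omega>" if "\<epsilon> \<in> eps_set" for \<epsilon>
    using y that by (auto simp: compact_points_def)
  \<comment> \<open>This is the splitting u(x) - v(y) = (u - v)(y) - (u(y) - u(x)), which changes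
    one representative at a time.\<close>
  have "negligible_net (\<lambda>\<epsilon>. (\<lambda>\<epsilon>\<in>eps_set. \<lambda>x\<in>\<Omega>. u \<epsilon> x - v \<epsilon> x) \<epsilon> (y \<epsilon>) + - (u \<epsilon> (y \<epsilon>) - u \<epsilon> (x \<epsilon>)))"
    by (intro negligible_net_add negligible_net_minus negligible_fun_eval[OF \<Omega> d y]
        moderate_fun_eval_diff[OF \<Omega> u x xy])
  \<comment> \<open>The two forms of the difference agree on \<open>eps_set\<close>, so they are
    compared eventually; the absolute value turns the known net into an upper bound.\<close>
  then have "negligible_net (\<lambda>\<epsilon>. \<bar>(\<lambda>\<epsilon>\<in>eps_set. \<lambda>x\<in>\<Omega>. u \<epsilon> x - v \<epsilon> x) \<epsilon> (y \<epsilon>) + - (u \<epsilon> (y \<epsilon>) - u \<epsilon> (x \<epsilon>))\<bar>)"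
    by simp
  then have "negligible_net (\<lambda>\<epsilon>. (\<lambda>\<epsilon>\<in>eps_set. u \<epsilon> (x \<epsilon>)) \<epsilon> - (\<lambda>\<epsilon>\<in>eps_set. v \<epsilon> (y \<epsilon>)) \<epsilon>)"
    by (rule negligible_net_mono) (use eventually_eps in eventually_elim, simp add: y\<Omega>)
  then show ?thesis
    using moderate_fun_eval[OF \<Omega> u x] moderate_fun_eval[OF \<Omega> v y] by (simp add: real_rel_def)
qed

text \<open>All classes united in \<open>gen_eval\<close> coincide, and the union is over nonempty
  sets, so it equals the class given by the chosen representatives.\<close>

lemma gen_eval_class:
  assumes \<Omega>: "openin (Euclidean_space n) \<Omega>" and u: "u \<in> moderate_funs n \<Omega>"
    and x: "x \<in> compact_points \<Omega>"
  shows "gen_eval (fun_rel n \<Omega> `` {u}, point_rel n \<Omega> `` {x}) = real_rel `` {\<lambda>\<epsilon>\<in>eps_set. u \<epsilon> (x \<epsilon>)}"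
proof -
  let ?F = "\<lambda>v y. real_rel `` {\<lambda>\<epsilon>\<in>eps_set. v \<epsilon> (y \<epsilon>)}"
  have eq: "?F v y = ?F u x" if "v \<in> fun_rel n \<Omega> `` {u}" "y \<in> point_rel n \<Omega> `` {x}" for v y
    using equiv_class_eq[OF equiv_real_rel eval_real_rel[OF \<Omega> _ x], of u v y] that by simp
  have uu: "u \<in> fun_rel n \<Omega> `` {u}" using fun_rel_refl[OF \<Omega> u] by simp
  have xx: "x \<in> point_rel n \<Omega> `` {x}"
    using point_rel_refl x compact_points_subset by blast
  have "(\<Union>v\<in>fun_rel n \<Omega> `` {u}. \<Union>y\<in>point_rel n \<Omega> `` {x}. ?F v y) =
      (\<Union>v\<in>fun_rel n \<Omega> `` {u}. \<Union>y\<in>point_rel n \<Omega> `` {x}. ?F u x)"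
    by (intro SUP_cong refl eq)
  \<comment> \<open>A constant union is empty over an empty index set; u and x exclude this.\<close>
  also have "\<dots> = ?F u x"
    unfolding UN_constant using uu xx by (metis empty_iff)
  finally show ?thesis by (simp add: gen_eval_def)
qed

section \<open>Smoothness of the evaluation map\<close>

text \<open>Evaluation of nets acts separately at each index \<epsilon>, so smoothness follows from
  applying evaluation of functional plots twice. Compact support enters only to make the values
  moderate.\<close>

lemma eval_plot:
  assumes \<Omega>: "openin (Euclidean_space n) \<Omega>"
    and e: "e \<in> plots (moderate_funs_space n \<Omega>) m V"
    and y: "y \<in> plots (moderate_points_space n \<Omega>) m V"
    and yc: "\<And>v. v \<in> V \<Longrightarrow> y v \<in> compact_points \<Omega>"
  shows "(\<lambda>v\<in>V. \<lambda>\<epsilon>\<in>eps_set. e v \<epsilon> (y v \<epsilon>)) \<in> plots moderate_reals_space m V"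
proof -
  let ?F = "smooth_functions_space n \<Omega>" and ?O = "open_diffeology n \<Omega>"
    and ?I = "discrete_diffeology eps_set"
  have e': "e \<in> plots (functional_diffeology ?I ?F) m V" "e \<in> V \<rightarrow> moderate_funs n \<Omega>"
    using e by (auto simp: moderate_funs_space_def sub_diffeology_def)
  have y': "y \<in> plots (functional_diffeology ?I ?O) m V"
    using y by (auto simp: moderate_points_space_def sub_diffeology_def)
  have V: "openin (Euclidean_space m) V" by (rule functional_plotD(1)[OF y'])
  have mod: "(\<lambda>\<epsilon>\<in>eps_set. e v \<epsilon> (y v \<epsilon>)) \<in> moderate_reals" if "v \<in> V" for v
    using e'(2) that by (intro moderate_fun_eval[OF \<Omega> _ yc[OF that]]) auto
  have "(\<lambda>v\<in>V. \<lambda>\<epsilon>\<in>eps_set. e v \<epsilon> (y v \<epsilon>)) \<in> plots (functional_diffeology ?I real_diffeology) m V"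
  proof (rule functional_plotI[OF diffeological_space_real _ V])
    show "(\<lambda>v\<in>V. \<lambda>\<epsilon>\<in>eps_set. e v \<epsilon> (y v \<epsilon>)) \<in> V \<rightarrow>\<^sub>E smooth_maps ?I real_diffeology"
      unfolding smooth_maps_discrete[OF diffeological_space_real]
      by (auto simp: real_diffeology_def)
    fix k W p q
    assume *: "p \<in> plots (open_diffeology m V) k W" "q \<in> plots ?I k W" "p \<in> W \<rightarrow> V"
      "q \<in> W \<rightarrow> points ?I"
    have W: "openin (Euclidean_space k) W" using *(1) by (simp add: open_diffeology_def)
    have q: "q \<in> W \<rightarrow>\<^sub>E points ?I" by (rule plot_fun[OF diffeological_space_discrete *(2)])
    \<comment> \<open>For a test pair p, q both families are first evaluated at parameter
      \<open>p w\<close> and index \<open>q w\<close>, giving a smooth family of functions and one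
      of points.\<close>
    have E: "(\<lambda>w\<in>W. e (p w) (q w)) \<in> plots (functional_diffeology ?O real_diffeology) k W"
      using functional_plot_eval[OF e'(1) *(1,2) q] by (simp add: smooth_functions_space_def)
    have Y: "(\<lambda>w\<in>W. y (p w) (q w)) \<in> plots ?O k W"
      by (rule functional_plot_eval[OF y' *(1,2) q])
    \<comment> \<open>The identity plot lets the second evaluation use the same w for the function
      and for its argument.\<close>
    have "smooth_between k W k W (\<lambda>w\<in>W. w)"
      by (rule smooth_between_cong[OF W smooth_between_id[OF W order_refl]]) simp
    then have "(\<lambda>w\<in>W. w) \<in> plots (open_diffeology k W) k W"
      using W by (simp add: open_diffeology_def)
    from functional_plot_eval[OF E this Y plot_fun[OF diffeological_space_open[OF \<Omega>] Y]]
    have "(\<lambda>w\<in>W. e (p w) (q w) (y (p w) (q w))) \<in> plots real_diffeology k W"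
      by (simp cong: restrict_cong)
    moreover have "(\<lambda>w\<in>W. e (p w) (q w) (y (p w) (q w))) =
        (\<lambda>w\<in>W. (\<lambda>v\<in>V. \<lambda>\<epsilon>\<in>eps_set. e v \<epsilon> (y v \<epsilon>)) (p w) (q w))"
      using *(3,4) by (intro restrict_ext) (auto simp: discrete_diffeology_def Pi_iff)
    ultimately show "(\<lambda>w\<in>W. (\<lambda>v\<in>V. \<lambda>\<epsilon>\<in>eps_set. e v \<epsilon> (y v \<epsilon>)) (p w) (q w)) \<in> plots real_diffeology k W"
      by simp
  qed
  then show ?thesis using mod by (simp add: moderate_reals_space_def sub_diffeology_def)
qed

section \<open>Local lifts of plots and their restriction\<close>

lemma quotient_plot_lift:
  assumes "d \<in> plots (quotient_diffeology X r) m U" "u \<in> U"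
  obtains V e where "u \<in> V" "V \<subseteq> U" "openin (Euclidean_space m) V" "e \<in> plots X m V"
    "\<And>v. v \<in> V \<Longrightarrow> d v = r `` {e v}"
proof -
  have "\<forall>u\<in>U. \<exists>V. u \<in> V \<and> V \<subseteq> U \<and> openin (Euclidean_space m) V \<and>
      (\<exists>e\<in>plots X m V. \<forall>v\<in>V. d v = r `` {e v})"
    using assms(1) by (simp add: quotient_diffeology_def)
  from bspec[OF this assms(2)] show thesis using that by blast
qed

lemma diffeological_space_moderate_funs:
  assumes "openin (Euclidean_space n) \<Omega>"
  shows "diffeological_space (moderate_funs_space n \<Omega>)"
proof -
  have Y: "diffeological_space (smooth_functions_space n \<Omega>)"
    using assms by (rule diffeological_space_smooth_functions)
  show ?thesis unfolding moderate_funs_space_def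
    by (intro diffeological_space_sub diffeological_space_functional diffeological_space_discrete Y)
      (auto simp: smooth_maps_discrete[OF Y] moderate_funs_def)
qed

lemma diffeological_space_moderate_points:
  assumes "openin (Euclidean_space n) \<Omega>"
  shows "diffeological_space (moderate_points_space n \<Omega>)"
proof -
  have Y: "diffeological_space (open_diffeology n \<Omega>)"
    using assms by (rule diffeological_space_open)
  have "points (open_diffeology n \<Omega>) = \<Omega>" by (simp add: open_diffeology_def)
  then show ?thesis unfolding moderate_points_space_def
    by (intro diffeological_space_sub diffeological_space_functional diffeological_space_discrete Y)
      (auto simp: smooth_maps_discrete[OF Y] moderate_points_def)
qed

text \<open>Since y belongs to its own class, it is equivalent to a compactly supported x and
  inherits compact support from it.\<close>

lemma class_in_compact_quotient:
  assumes \<Omega>: "openin (Euclidean_space n) \<Omega>" and y: "y \<in> moderate_points n \<Omega>"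
    and "point_rel n \<Omega> `` {y} \<in> compact_points \<Omega> // point_rel n \<Omega>"
  shows "y \<in> compact_points \<Omega>"
proof -
  obtain x where x: "x \<in> compact_points \<Omega>" "point_rel n \<Omega> `` {y} = point_rel n \<Omega> `` {x}"
    using assms(3) by (auto simp: quotient_def)
  then have "(x, y) \<in> point_rel n \<Omega>" using point_rel_refl[OF y] by blast
  then show ?thesis by (rule point_rel_compact_points[OF \<Omega> x(1)])
qed

lemma points_generalized_reals: "points generalized_reals = moderate_reals // real_rel"
  by (simp add: generalized_reals_def quotient_diffeology_def moderate_reals_space_def
      sub_diffeology_def)

lemma gen_eval_in_generalized_reals:
  assumes \<Omega>: "openin (Euclidean_space n) \<Omega>"
    and z: "z \<in> points (prod_diffeology (special_colombeau n \<Omega>) (compact_generalized_points n \<Omega>))"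
  shows "gen_eval z \<in> points generalized_reals"
proof -
  have "fst z \<in> moderate_funs n \<Omega> // fun_rel n \<Omega>" "snd z \<in> compact_points \<Omega> // point_rel n \<Omega>"
    using z by (auto simp: prod_diffeology_def special_colombeau_def quotient_diffeology_def
        moderate_funs_space_def compact_generalized_points_def sub_diffeology_def)
  then obtain u x where ux: "u \<in> moderate_funs n \<Omega>" "x \<in> compact_points \<Omega>"
    "z = (fun_rel n \<Omega> `` {u}, point_rel n \<Omega> `` {x})"
    by (metis prod.collapse quotientE)
  show ?thesis
    unfolding ux(3) gen_eval_class[OF \<Omega> ux(1,2)] points_generalized_reals
    by (intro quotientI moderate_fun_eval[OF \<Omega> ux(1,2)])
qed

text \<open>Both components of a plot lift near each parameter; evaluating the lifts pointwise gives
  a lift of the evaluated plot.\<close>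

lemma smooth_gen_eval:
  assumes \<Omega>: "openin (Euclidean_space n) \<Omega>"
  shows "smooth_map (prod_diffeology (special_colombeau n \<Omega>) (compact_generalized_points n \<Omega>))
    generalized_reals gen_eval"
  unfolding smooth_map_def
proof (intro conjI allI ballI)
  let ?P = "prod_diffeology (special_colombeau n \<Omega>) (compact_generalized_points n \<Omega>)"
  show "gen_eval \<in> points ?P \<rightarrow> points generalized_reals"
    using gen_eval_in_generalized_reals[OF \<Omega>] by blast
  fix m U d assume d: "d \<in> plots ?P m U"
  have d0: "d \<in> U \<rightarrow> points ?P"
    using d by (auto simp: prod_diffeology_def)
  have d1: "compose U fst d \<in> plots (quotient_diffeology (moderate_funs_space n \<Omega>) (fun_rel n \<Omega>)) m U"
    using d by (simp add: prod_diffeology_def special_colombeau_def)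
  \<comment> \<open>The diffeology on compactly supported points is inherited from all generalized
    points, so a lift is at first only moderate; \<open>dc\<close> keeps the missing
    information.\<close>
  have d2: "compose U snd d \<in> plots (quotient_diffeology (moderate_points_space n \<Omega>) (point_rel n \<Omega>)) m U"
    and dc: "compose U snd d \<in> U \<rightarrow> compact_points \<Omega> // point_rel n \<Omega>"
    using d by (simp_all add: prod_diffeology_def compact_generalized_points_def
        generalized_points_def sub_diffeology_def)
  have U: "openin (Euclidean_space m) U" using d1 by (simp add: quotient_diffeology_def)
  have "\<exists>V. u \<in> V \<and> V \<subseteq> U \<and> openin (Euclidean_space m) V \<and>
      (\<exists>e\<in>plots moderate_reals_space m V. \<forall>v\<in>V. compose U gen_eval d v = real_rel `` {e v})"
    if u: "u \<in> U" for u
  proof -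
    obtain V1 e where V1: "u \<in> V1" "V1 \<subseteq> U" "openin (Euclidean_space m) V1"
      "e \<in> plots (moderate_funs_space n \<Omega>) m V1"
      "\<And>v. v \<in> V1 \<Longrightarrow> compose U fst d v = fun_rel n \<Omega> `` {e v}"
      using quotient_plot_lift[OF d1 u] by metis
    obtain V2 y where V2: "u \<in> V2" "V2 \<subseteq> U" "openin (Euclidean_space m) V2"
      "y \<in> plots (moderate_points_space n \<Omega>) m V2"
      "\<And>v. v \<in> V2 \<Longrightarrow> compose U snd d v = point_rel n \<Omega> `` {y v}"
      using quotient_plot_lift[OF d2 u] by metis
    \<comment> \<open>The two components may lift on different neighbourhoods.\<close>
    define V where "V = V1 \<inter> V2"
    have V: "openin (Euclidean_space m) V" "V \<subseteq> U" "u \<in> V"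
      using V1(1-3) V2(1-3) by (auto simp: V_def)
    have e: "restrict e V \<in> plots (moderate_funs_space n \<Omega>) m V"
      by (rule plot_restrict[OF diffeological_space_moderate_funs[OF \<Omega>] V1(4) V(1)]) (simp add: V_def)
    have y: "restrict y V \<in> plots (moderate_points_space n \<Omega>) m V"
      by (rule plot_restrict[OF diffeological_space_moderate_points[OF \<Omega>] V2(4) V(1)]) (simp add: V_def)
    have eM: "e v \<in> moderate_funs n \<Omega>" if "v \<in> V" for v
      using e that by (force simp: moderate_funs_space_def sub_diffeology_def)
    \<comment> \<open>Compact support is recovered for each parameter v separately.\<close>
    have yC: "y v \<in> compact_points \<Omega>" if "v \<in> V" for v
    proof (rule class_in_compact_quotient[OF \<Omega>])
      show "y v \<in> moderate_points n \<Omega>"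
        using y that by (force simp: moderate_points_space_def sub_diffeology_def)
      have v: "v \<in> V2" "v \<in> U" using that V(2) by (auto simp: V_def)
      then show "point_rel n \<Omega> `` {y v} \<in> compact_points \<Omega> // point_rel n \<Omega>"
        unfolding V2(5)[OF v(1), symmetric] using dc by blast
    qed
    define f where "f = (\<lambda>v\<in>V. \<lambda>\<epsilon>\<in>eps_set. restrict e V v \<epsilon> (restrict y V v \<epsilon>))"
    have f: "f \<in> plots moderate_reals_space m V"
      unfolding f_def by (rule eval_plot[OF \<Omega> e y]) (simp add: yC)
    have "compose U gen_eval d v = real_rel `` {f v}" if "v \<in> V" for v
    proof -
      have v: "v \<in> U" "v \<in> V1" "v \<in> V2" using that V(2) by (auto simp: V_def)
      have "d v = (fun_rel n \<Omega> `` {e v}, point_rel n \<Omega> `` {y v})"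
        using V1(5)[OF v(2)] V2(5)[OF v(3)] v(1) by (simp add: compose_eq prod_eq_iff)
      then show ?thesis
        using gen_eval_class[OF \<Omega> eM[OF that] yC[OF that]] v(1) that by (simp add: compose_eq f_def)
    qed
    with V f show ?thesis by blast
  qed
  moreover have "compose U gen_eval d \<in> U \<rightarrow>\<^sub>E points generalized_reals"
    using d0 gen_eval_in_generalized_reals[OF \<Omega>]
    by (intro PiE_I) (simp_all add: compose_def Pi_iff)
  ultimately show "compose U gen_eval d \<in> plots generalized_reals m U"
    using U by (simp add: generalized_reals_def quotient_diffeology_def)
qed

text \<open>The first conjunct certifies that the union defining \<open>gen_eval\<close> is
  evaluation on representatives, so the second speaks about the intended map.\<close>

theorem theorem58:
  fixes n :: nat and \<Omega> :: "(nat \<Rightarrow> real) set"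
  assumes "openin (Euclidean_space n) \<Omega>"
  shows "(\<forall>u \<in> moderate_funs n \<Omega>. \<forall>x \<in> compact_points \<Omega>.
            gen_eval (fun_rel n \<Omega> `` {u}, point_rel n \<Omega> `` {x}) =
              real_rel `` {\<lambda>\<epsilon>\<in>eps_set. u \<epsilon> (x \<epsilon>)}) \<and>
         smooth_map
           (prod_diffeology (special_colombeau n \<Omega>) (compact_generalized_points n \<Omega>))
           generalized_reals
           gen_eval"
  using gen_eval_class[OF assms] smooth_gen_eval[OF assms] by blast

end
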